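(* Let $n,r$ be positive integers. The expression algorithm described in the context is correct and terminates: for every input $f=P-Q$ that is $S_n$-invariant as a function on $\mathbb{R}^{n\times r}$, the algorithm (in either variant of step 3) halts, and its output is a tropical rational expression $g$ in the $K$ variables $w_c$ ($0<|c|\le n$) with $g\circ\Phi=f$.
   Context: $\mathbb{N}=\{0,1,2,\dots\}$; $e_\alpha$ is the $\alpha$th standard basis vector of $\mathbb{N}^r$. $S_n$ acts on $\mathbb{R}^{n\times r}$ by permuting rows; $[M]$ is the orbit of $M$. For $M=(m_{i\alpha})$ and $c\in\mathbb{N}^r$ with $0<|c|:=c_1+\cdots+c_r\le n$, $$b_c(M)=\max\Bigl\{\sum_{\alpha=1}^r\sum_{i\in I_\alpha} m_{i\alpha} : I_1,\dots,I_r\subseteq\{1,\dots,n\}\text{ pairwise disjoint},\ \#I_\alpha=c_\alpha\Bigr\},\quad b_0=0.$$ Put $K=\binom{n+r}{r}-1$, $\Phi=(b_c)_{0<|c|\le n}:\mathbb{R}^{n\times r}\to\mathbb{R}^K$; coordinates on $\mathbb{R}^K$ are $w_c$, and $w_0:=0$. Let $d([M],[\bar M])=\min_{\pi\in S_n}\|M-\pi\cdot\bar M\|_2$. It is known that there is a constant $c_{n,r}>0$ with $\|\Phi(M)-\Phi(\bar M)\|_2\ge c_{n,r}\,d([M],[\bar M])$ for all $M,\bar M$. A tropical polynomial is a finite maximum of affine functions $\gamma+\langle a,z\rangle$ with $\gamma\in\mathbb{R}$, $a\in\mathbb{Z}_{\ge0}^m$; a tropical rational function is a difference of two tropical polynomials,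 and a tropical rational expression is one built using $\max$, $\min$, $+$, $-$ (and integer multiples) from variables and constants. For $\vec\sigma=(\sigma_2,\dots,\sigma_r)\in S_n^{\,r-1}$ set $\sigma_1=\mathrm{id}$, and let $\widehat M_{\vec\sigma}(w)$ be the $n\times r$ matrix with entries $w_{\sigma_\alpha(i)e_\alpha}-w_{(\sigma_\alpha(i)-1)e_\alpha}$. Algorithm. Input: an expression $f=P-Q$ in the variables $m_{i\alpha}$, with $P=\max_j(\gamma_j+\langle a_j,\cdot\rangle)$ and $Q=\max_k(\gamma'_k+\langle a'_k,\cdot\rangle)$ tropical polynomials, such that $f$ is $S_n$-invariant as a function. 1. (Lipschitz bound) Set $L:=\max_j\|a_j\|_1+\max_k\|a'_k\|_1$. 2. (Coupling terms) For each $\vec\sigma\in S_n^{\,r-1}$ build $f_{\vec\sigma}(w)$ by substituting $m_{i\alpha}\leftarrow w_{\sigma_\alpha(i)e_\alpha}-w_{(\sigma_\alpha(i)-1)e_\alpha}$ into $f$, and build $D_{\vec\sigma}(w)=\max_c|w_c-b_c(\widehat M_{\vec\sigma}(w))|$, where $c$ ranges over the indices with $0<|c|\le n$ having at least two nonzero entries (an empty maximum is $0$). 3. (Constant) If an explicit $c_0$ with $0<c_0\le c_{n,r}$ is available, set $\kappa_f:=\lceil L\sqrt K/c_0\rceil$ and output $g=\min_{\vec\sigma}(f_{\vec\sigma}+\kappa_fD_{\vec\sigma})$. Otherwise, for $\kappa_f=1,2,4,\dots$ build $g_{\kappa_f}=\min_{\vec\sigma}(f_{\vec\sigma}+\kappa_fD_{\vec\sigma})$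 and test the identity $g_{\kappa_f}\circ\Phi\equiv f$ on $\mathbb{R}^{n\times r}$; output the first $g_{\kappa_f}$ that passes. *)

theory Defs
  imports "HOL-Analysis.Analysis" "HOL-Library.While_Combinator"
begin

section \<open>Matrices, orbits, and the map \<open>\<Phi>\<close>\<close>

text \<open>
  Indices are 1-based. A real \<open>n \<times> r\<close> matrix is a function on pairs
  \<open>(i, \<alpha>)\<close>, of which only the values on \<open>{1..n} \<times> {1..r}\<close> matter. An element
  \<open>c\<close> of \<open>\<nat>\<^sup>r\<close> is a function that vanishes outside \<open>{1..r}\<close>. A point of \<open>\<real>\<^sup>K\<close> is a
  function on the index set \<open>Idx n r\<close>, which has \<open>K = (n + r choose r) - 1\<close> elements.
\<close>

type_synonym entry = "nat \<times> nat"
type_synonym index = "nat \<Rightarrow> nat"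

definition Idx :: "nat \<Rightarrow> nat \<Rightarrow> index set" where
  "Idx n r = {c. (\<forall>\<alpha>. \<alpha> \<notin> {1..r} \<longrightarrow> c \<alpha> = 0) \<and> 0 < (\<Sum>\<alpha>=1..r. c \<alpha>) \<and> (\<Sum>\<alpha>=1..r. c \<alpha>) \<le> n}"

definition b :: "nat \<Rightarrow> nat \<Rightarrow> index \<Rightarrow> (entry \<Rightarrow> real) \<Rightarrow> real" where
  "b n r c M = (if c = (\<lambda>_. 0) then 0 else
     Max {\<Sum>\<alpha>=1..r. \<Sum>i\<in>I \<alpha>. M (i, \<alpha>) | I.
            (\<forall>\<alpha>\<in>{1..r}. I \<alpha> \<subseteq> {1..n} \<and> card (I \<alpha>) = c \<alpha>) \<and> disjoint_family_on I {1..r}})"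

definition Phi :: "nat \<Rightarrow> nat \<Rightarrow> (entry \<Rightarrow> real) \<Rightarrow> index \<Rightarrow> real" where
  "Phi n r M = restrict (\<lambda>c. b n r c M) (Idx n r)"

definition row_act :: "(nat \<Rightarrow> nat) \<Rightarrow> (entry \<Rightarrow> real) \<Rightarrow> entry \<Rightarrow> real" where
  "row_act \<pi> M = (\<lambda>(i, \<alpha>). M (inv \<pi> i, \<alpha>))"

definition orbit_dist :: "nat \<Rightarrow> nat \<Rightarrow> (entry \<Rightarrow> real) \<Rightarrow> (entry \<Rightarrow> real) \<Rightarrow> real" where
  "orbit_dist n r M N =
     Min {L2_set (\<lambda>p. M p - row_act \<pi> N p) ({1..n} \<times> {1..r}) | \<pi>. \<pi> permutes {1..n}}"

definition lower_Lipschitz_const :: "nat \<Rightarrow> nat \<Rightarrow> real \<Rightarrow> bool" where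
  "lower_Lipschitz_const n r C \<longleftrightarrow> 0 < C \<and>
     (\<forall>M N. L2_set (\<lambda>c. Phi n r M c - Phi n r N c) (Idx n r) \<ge> C * orbit_dist n r M N)"

section \<open>Tropical rational expressions\<close>

datatype (texp_vars: 'v) texp =
    TVar 'v
  | TConst real
  | TAdd "'v texp" "'v texp"
  | TSub "'v texp" "'v texp"
  | TMax "'v texp" "'v texp"
  | TMin "'v texp" "'v texp"
  | TMul int "'v texp"

primrec teval :: "'v texp \<Rightarrow> ('v \<Rightarrow> real) \<Rightarrow> real" where
  "teval (TVar v) x = x v"
| "teval (TConst k) x = k"
| "teval (TAdd s t) x = teval s x + teval t x"
| "teval (TSub s t) x = teval s x - teval t x"
| "teval (TMax s t) x = max (teval s x) (teval t x)"
| "teval (TMin s t) x = min (teval s x) (teval t x)"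
| "teval (TMul m t) x = of_int m * teval t x"

primrec tsubst :: "('v \<Rightarrow> 'w texp) \<Rightarrow> 'v texp \<Rightarrow> 'w texp" where
  "tsubst \<theta> (TVar v) = \<theta> v"
| "tsubst \<theta> (TConst k) = TConst k"
| "tsubst \<theta> (TAdd s t) = TAdd (tsubst \<theta> s) (tsubst \<theta> t)"
| "tsubst \<theta> (TSub s t) = TSub (tsubst \<theta> s) (tsubst \<theta> t)"
| "tsubst \<theta> (TMax s t) = TMax (tsubst \<theta> s) (tsubst \<theta> t)"
| "tsubst \<theta> (TMin s t) = TMin (tsubst \<theta> s) (tsubst \<theta> t)"
| "tsubst \<theta> (TMul m t) = TMul m (tsubst \<theta> t)"

definition tsum_list :: "'v texp list \<Rightarrow> 'v texp" where
  "tsum_list ts = foldr TAdd ts (TConst 0)"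

text \<open>The empty maximum is 0 by convention; the empty minimum never arises.\<close>

fun tmax_list :: "'v texp list \<Rightarrow> 'v texp" where
  "tmax_list [] = TConst 0"
| "tmax_list [t] = t"
| "tmax_list (t # ts) = TMax t (tmax_list ts)"

fun tmin_list :: "'v texp list \<Rightarrow> 'v texp" where
  "tmin_list [] = TConst 0"
| "tmin_list [t] = t"
| "tmin_list (t # ts) = TMin t (tmin_list ts)"

definition tabs :: "'v texp \<Rightarrow> 'v texp" where
  "tabs t = TMax t (TMul (-1) t)"

section \<open>The input\<close>

text \<open>
  A tropical polynomial is the nonempty list of its terms \<open>(\<gamma>, a)\<close>, each standing for the
  affine function \<open>\<gamma> + \<langle>a, \<cdot>\<rangle>\<close>.
\<close>

type_synonym trop_poly = "(real \<times> (entry \<Rightarrow> nat)) list"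

definition entries :: "nat \<Rightarrow> nat \<Rightarrow> entry list" where
  "entries n r = List.product [1..<Suc n] [1..<Suc r]"

definition poly_expr :: "nat \<Rightarrow> nat \<Rightarrow> trop_poly \<Rightarrow> entry texp" where
  "poly_expr n r ts = tmax_list
     [TAdd (TConst \<gamma>) (tsum_list [TMul (int (a v)) (TVar v). v \<leftarrow> entries n r]). (\<gamma>, a) \<leftarrow> ts]"

definition input_expr :: "nat \<Rightarrow> nat \<Rightarrow> trop_poly \<Rightarrow> trop_poly \<Rightarrow> entry texp" where
  "input_expr n r P Q = TSub (poly_expr n r P) (poly_expr n r Q)"

definition row_invariant :: "nat \<Rightarrow> entry texp \<Rightarrow> bool" where
  "row_invariant n f \<longleftrightarrow> (\<forall>\<pi> M. \<pi> permutes {1..n} \<longrightarrow> teval f (row_act \<pi> M) = teval f M)"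

definition max_norm1 :: "nat \<Rightarrow> nat \<Rightarrow> trop_poly \<Rightarrow> nat" where
  "max_norm1 n r ts = Max ((\<lambda>(\<gamma>, a). \<Sum>v\<in>{1..n} \<times> {1..r}. a v) ` set ts)"

definition Lip_bound :: "nat \<Rightarrow> nat \<Rightarrow> trop_poly \<Rightarrow> trop_poly \<Rightarrow> nat" where
  "Lip_bound n r P Q = max_norm1 n r P + max_norm1 n r Q"

section \<open>Coupling terms\<close>

text \<open>
  A family \<open>I\<^sub>1, \<dots>, I\<^sub>r\<close> of subsets of \<open>{1..n}\<close> is enumerated as a list \<open>Is\<close> of increasing
  lists, \<open>Is ! (\<alpha> - 1)\<close> listing \<open>I\<^sub>\<alpha>\<close>. The matrix entries \<open>m\<close> are themselves expressions.
\<close>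

definition families :: "nat \<Rightarrow> nat \<Rightarrow> index \<Rightarrow> nat list list list" where
  "families n r c = filter (\<lambda>Is. (\<forall>\<alpha>\<in>{1..r}. length (Is ! (\<alpha> - 1)) = c \<alpha>) \<and>
       disjoint_family_on (\<lambda>\<alpha>. set (Is ! (\<alpha> - 1))) {1..r})
     (List.n_lists r (subseqs [1..<Suc n]))"

definition b_expr :: "nat \<Rightarrow> nat \<Rightarrow> index \<Rightarrow> (entry \<Rightarrow> 'v texp) \<Rightarrow> 'v texp" where
  "b_expr n r c m = tmax_list
     [tsum_list [m (i, \<alpha>). \<alpha> \<leftarrow> [1..<Suc r], i \<leftarrow> Is ! (\<alpha> - 1)]. Is \<leftarrow> families n r c]"

definition index_of_list :: "nat \<Rightarrow> nat list \<Rightarrow> index" where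
  "index_of_list r xs = (\<lambda>\<alpha>. if \<alpha> \<in> {1..r} then xs ! (\<alpha> - 1) else 0)"

definition mixed_indices :: "nat \<Rightarrow> nat \<Rightarrow> index list" where
  "mixed_indices n r =
     filter (\<lambda>c. (\<Sum>\<alpha>=1..r. c \<alpha>) \<le> n \<and> 2 \<le> card {\<alpha>\<in>{1..r}. c \<alpha> \<noteq> 0})
       (map (index_of_list r) (List.n_lists r [0..<Suc n]))"

text \<open>The coordinate \<open>w\<^bsub>k e\<^sub>\<alpha>\<^esub>\<close>, with \<open>w\<^sub>0 = 0\<close>.\<close>

definition pure_coord :: "nat \<Rightarrow> nat \<Rightarrow> index texp" where
  "pure_coord k \<alpha> = (if k = 0 then TConst 0 else TVar (\<lambda>\<beta>. if \<beta> = \<alpha> then k else 0))"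

text \<open>
  A tuple \<open>(\<sigma>\<^sub>1, \<dots>, \<sigma>\<^sub>r)\<close> with \<open>\<sigma>\<^sub>1 = id\<close> is a list of \<open>r\<close> permutations, each in one-line
  notation: \<open>\<sigma>\<^sub>\<alpha>(i)\<close> is \<open>\<sigma> ! (\<alpha> - 1) ! (i - 1)\<close>.
\<close>

definition perm_lists :: "nat \<Rightarrow> nat list list" where
  "perm_lists n = filter distinct (List.n_lists n [1..<Suc n])"

definition perm_tuples :: "nat \<Rightarrow> nat \<Rightarrow> nat list list list" where
  "perm_tuples n r = map (\<lambda>\<sigma>. [1..<Suc n] # \<sigma>) (List.n_lists (r - 1) (perm_lists n))"

definition M_hat :: "nat list list \<Rightarrow> entry \<Rightarrow> index texp" where
  "M_hat \<sigma> = (\<lambda>(i, \<alpha>). let k = \<sigma> ! (\<alpha> - 1) ! (i - 1) in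
     TSub (pure_coord k \<alpha>) (pure_coord (k - 1) \<alpha>))"

definition D_expr :: "nat \<Rightarrow> nat \<Rightarrow> nat list list \<Rightarrow> index texp" where
  "D_expr n r \<sigma> =
     tmax_list [tabs (TSub (TVar c) (b_expr n r c (M_hat \<sigma>))). c \<leftarrow> mixed_indices n r]"

definition g_expr :: "nat \<Rightarrow> nat \<Rightarrow> trop_poly \<Rightarrow> trop_poly \<Rightarrow> int \<Rightarrow> index texp" where
  "g_expr n r P Q \<kappa> = tmin_list
     [TAdd (tsubst (M_hat \<sigma>) (input_expr n r P Q)) (TMul \<kappa> (D_expr n r \<sigma>)). \<sigma> \<leftarrow> perm_tuples n r]"

section \<open>A decision procedure for identities of tropical rational expressions\<close>

text \<open>
  The test is carried out with finitely many field operations and comparisons of real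
  numbers: an expression is split into affine pieces on polyhedra, and it vanishes identically
  iff no piece is positive or negative somewhere on its polyhedron, which Fourier-Motzkin
  elimination decides. Its correctness is the lemma \<open>identity_test_iff\<close> below.

  \<open>(k, a)\<close> is the affine function \<open>k + (\<Sum>v. a v * x v)\<close>; a constraint \<open>(s, l)\<close> says
  \<open>0 < l\<close> if \<open>s\<close> and \<open>0 \<le> l\<close> otherwise.
\<close>

type_synonym 'v affine_fun = "real \<times> ('v \<Rightarrow> real)"
type_synonym 'v constraint = "bool \<times> 'v affine_fun"

definition aff_lin :: "real \<Rightarrow> 'v affine_fun \<Rightarrow> real \<Rightarrow> 'v affine_fun \<Rightarrow> 'v affine_fun" where
  "aff_lin s l t m = (s * fst l + t * fst m, \<lambda>v. s * snd l v + t * snd m v)"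

fun feasible :: "'v list \<Rightarrow> 'v constraint list \<Rightarrow> bool" where
  "feasible [] cs = (\<forall>(s, l)\<in>set cs. if s then 0 < fst l else 0 \<le> fst l)"
| "feasible (v # vs) cs = feasible vs
     (filter (\<lambda>(s, l). snd l v = 0) cs @
      [(s \<or> t, aff_lin (- snd m v) l (snd l v) m).
         (s, l) \<leftarrow> filter (\<lambda>(s, l). 0 < snd l v) cs,
         (t, m) \<leftarrow> filter (\<lambda>(t, m). snd m v < 0) cs])"

primrec pieces :: "'v texp \<Rightarrow> ('v constraint list \<times> 'v affine_fun) list" where
  "pieces (TVar v) = [([], (0, \<lambda>u. if u = v then 1 else 0))]"
| "pieces (TConst k) = [([], (k, \<lambda>u. 0))]"
| "pieces (TAdd s t) = [(C @ D, aff_lin 1 l 1 m). (C, l) \<leftarrow> pieces s, (D, m) \<leftarrow> pieces t]"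
| "pieces (TSub s t) = [(C @ D, aff_lin 1 l (-1) m). (C, l) \<leftarrow> pieces s, (D, m) \<leftarrow> pieces t]"
| "pieces (TMax s t) = [p. (C, l) \<leftarrow> pieces s, (D, m) \<leftarrow> pieces t,
     p \<leftarrow> [((False, aff_lin 1 l (-1) m) # C @ D, l), ((False, aff_lin 1 m (-1) l) # C @ D, m)]]"
| "pieces (TMin s t) = [p. (C, l) \<leftarrow> pieces s, (D, m) \<leftarrow> pieces t,
     p \<leftarrow> [((False, aff_lin 1 m (-1) l) # C @ D, l), ((False, aff_lin 1 l (-1) m) # C @ D, m)]]"
| "pieces (TMul k t) = [(C, aff_lin (of_int k) l 0 l). (C, l) \<leftarrow> pieces t]"

definition vanishes :: "'v list \<Rightarrow> 'v texp \<Rightarrow> bool" where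
  "vanishes vs t \<longleftrightarrow> (\<forall>(C, l)\<in>set (pieces t).
     \<not> feasible vs ((True, l) # C) \<and> \<not> feasible vs ((True, aff_lin (-1) l 0 l) # C))"

definition identity_test :: "nat \<Rightarrow> nat \<Rightarrow> index texp \<Rightarrow> entry texp \<Rightarrow> bool" where
  "identity_test n r g f =
     vanishes (entries n r) (TSub (tsubst (\<lambda>c. b_expr n r c TVar) g) f)"

definition sign_ok :: "bool \<Rightarrow> real \<Rightarrow> bool" where
  "sign_ok s x = (if s then 0 < x else 0 \<le> x)"

definition aff_val :: "'v list \<Rightarrow> 'v affine_fun \<Rightarrow> ('v \<Rightarrow> real) \<Rightarrow> real" where
  "aff_val vs l x = fst l + (\<Sum>v\<leftarrow>vs. snd l v * x v)"

lemma aff_val_lin: "aff_val vs (aff_lin s l t m) x = s * aff_val vs l x + t * aff_val vs m x"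
  by (induction vs) (auto simp: aff_val_def aff_lin_def algebra_simps)

lemma one_variable:
  fixes p a :: "'c \<Rightarrow> real"
  assumes "finite S"
  shows "(\<exists>t. \<forall>c\<in>S. sign_ok (s c) (p c + a c * t)) \<longleftrightarrow>
    (\<forall>c\<in>S. a c = 0 \<longrightarrow> sign_ok (s c) (p c)) \<and>
    (\<forall>c\<in>S. \<forall>d\<in>S. 0 < a c \<longrightarrow> a d < 0 \<longrightarrow> sign_ok (s c \<or> s d) (a c * p d - a d * p c))"
    (is "?L \<longleftrightarrow> ?Z \<and> ?PN")
proof (intro iffI conjI)
  assume ?L
  then obtain t where t: "\<forall>c\<in>S. sign_ok (s c) (p c + a c * t)" by blast
  show ?Z using t by force
  show ?PN
  proof (intro ballI impI)
    fix c d assume *: "c \<in> S" "d \<in> S" "0 < a c" "a d < 0"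
    have eq: "a c * p d - a d * p c = a c * (p d + a d * t) + (- a d) * (p c + a c * t)"
      by (simp add: algebra_simps)
    have c: "sign_ok (s c) (p c + a c * t)" and d: "sign_ok (s d) (p d + a d * t)"
      using t * by auto
    define A B where "A = p c + a c * t" and "B = p d + a d * t"
    have "0 \<le> A" "s c \<Longrightarrow> 0 < A" "0 \<le> B" "s d \<Longrightarrow> 0 < B"
      using c d by (auto simp: sign_ok_def A_def B_def split: if_splits)
    then have "0 \<le> a c * B" "s d \<Longrightarrow> 0 < a c * B" "0 \<le> (- a d) * A" "s c \<Longrightarrow> 0 < (- a d) * A"
      using * by (simp_all only: neg_0_less_iff_less mult_pos_pos mult_nonneg_nonneg
          less_imp_le neg_0_le_iff_le)
    then show "sign_ok (s c \<or> s d) (a c * p d - a d * p c)"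
      unfolding eq sign_ok_def A_def[symmetric] B_def[symmetric] by fastforce
  qed
next
  assume ZPN: "?Z \<and> ?PN"
  define q where "q c = - p c / a c" for c
  define Lo where "Lo = {c\<in>S. 0 < a c}"
  define Up where "Up = {c\<in>S. a c < 0}"
  have fin: "finite Lo" "finite Up" using assms by (auto simp: Lo_def Up_def)
  have LoI: "sign_ok (s c) (p c + a c * t)" if "c \<in> Lo" "q c < t \<or> q c = t \<and> \<not> s c" for c t
    using that by (auto simp: Lo_def q_def sign_ok_def field_simps)
  have UpI: "sign_ok (s c) (p c + a c * t)" if "c \<in> Up" "t < q c \<or> t = q c \<and> \<not> s c" for c t
    using that by (auto simp: Up_def q_def sign_ok_def field_simps)
  have le: "q c < q d \<or> q c = q d \<and> \<not> s c \<and> \<not> s d" if "c \<in> Lo" "d \<in> Up" for c d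
  proof -
    have "sign_ok (s c \<or> s d) (a c * p d - a d * p c)" "0 < a c" "a d < 0"
      using ZPN that by (auto simp: Lo_def Up_def)
    then show ?thesis by (auto simp: q_def sign_ok_def field_simps split: if_splits)
  qed
  have "\<exists>t. (\<forall>c\<in>Lo. q c < t \<or> q c = t \<and> \<not> s c) \<and> (\<forall>c\<in>Up. t < q c \<or> t = q c \<and> \<not> s c)"
  proof (cases "Lo = {}")
    case True
    have "\<forall>c\<in>Up. Min (q ` Up) - 1 < q c"
      using fin(2) by (meson Min_le finite_imageI imageI diff_less zero_less_one
          less_le_trans diff_less_eq le_less_trans less_add_one)
    with True show ?thesis by auto
  next
    case LoN: False
    show ?thesis
    proof (cases "Up = {}")
      case True
      have "\<forall>c\<in>Lo. q c < Max (q ` Lo) + 1"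
        using fin(1) by (meson Max_ge finite_imageI imageI less_add_one order_le_less_trans)
      with True show ?thesis by auto
    next
      case UpN: False
      obtain c where c: "c \<in> Lo" "q c = Max (q ` Lo)"
        using Max_in[of "q ` Lo"] fin LoN by (metis (no_types, lifting) finite_imageI imageE image_is_empty)
      obtain d where d: "d \<in> Up" "q d = Min (q ` Up)"
        using Min_in[of "q ` Up"] fin UpN by (metis (no_types, lifting) finite_imageI imageE image_is_empty)
      have cm: "q c' \<le> q c" if "c' \<in> Lo" for c' using c fin that by simp
      have dm: "q d \<le> q d'" if "d' \<in> Up" for d' using d fin that by simp
      show ?thesis
      proof (cases "q c < q d")
        case True
        then have *: "q c < (q c + q d) / 2" "(q c + q d) / 2 < q d" by auto
        show ?thesis
          by (rule exI[of _ "(q c + q d) / 2"]) (use * cm dm in fastforce)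
      next
        case False
        then have eq: "q c = q d" using le[OF c(1) d(1)] by auto
        show ?thesis
        proof (rule exI[of _ "q c"], intro conjI ballI)
          fix c' assume "c' \<in> Lo"
          then show "q c' < q c \<or> q c' = q c \<and> \<not> s c'" using le[of c' d] d eq by auto
        next
          fix d' assume "d' \<in> Up"
          then show "q c < q d' \<or> q c = q d' \<and> \<not> s d'" using le[of c d'] c by auto
        qed
      qed
    qed
  qed
  then obtain t where t: "\<forall>c\<in>Lo. q c < t \<or> q c = t \<and> \<not> s c" "\<forall>c\<in>Up. t < q c \<or> t = q c \<and> \<not> s c"
    by blast
  have "\<forall>c\<in>S. sign_ok (s c) (p c + a c * t)"
  proof
    fix c assume "c \<in> S"
    then consider "a c = 0" | "c \<in> Lo" | "c \<in> Up" by (force simp: Lo_def Up_def)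
    then show "sign_ok (s c) (p c + a c * t)"
      using t LoI UpI ZPN \<open>c \<in> S\<close> by cases auto
  qed
  then show ?L by blast
qed

lemma feasible_iff:
  assumes "distinct vs"
  shows "feasible vs cs \<longleftrightarrow> (\<exists>x. \<forall>(s, l)\<in>set cs. sign_ok s (aff_val vs l x))"
  using assms
proof (induction vs arbitrary: cs)
  case Nil
  show ?case by (auto simp: sign_ok_def aff_val_def)
next
  case (Cons v vs)
  have upd: "aff_val (v # vs) l (x(v := t)) = aff_val vs l x + snd l v * t" for l x t
  proof -
    have "(\<Sum>u\<leftarrow>vs. snd l u * (x(v := t)) u) = (\<Sum>u\<leftarrow>vs. snd l u * x u)"
      using Cons.prems by (intro arg_cong[where f = sum_list] map_cong) auto
    then show ?thesis by (simp add: aff_val_def)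
  qed
  have ex: "(\<exists>x. R x) \<longleftrightarrow> (\<exists>x t. R (x(v := t)))" for R :: "('a \<Rightarrow> real) \<Rightarrow> bool"
    by (metis fun_upd_triv)
  have "(\<exists>x. \<forall>(s, l)\<in>set cs. sign_ok s (aff_val (v # vs) l x)) \<longleftrightarrow>
        (\<exists>x t. \<forall>(s, l)\<in>set cs. sign_ok s (aff_val (v # vs) l (x(v := t))))"
    by (rule ex)
  also have "\<dots> \<longleftrightarrow> (\<exists>x. \<exists>t. \<forall>c\<in>set cs. sign_ok (fst c) (aff_val vs (snd c) x + snd (snd c) v * t))"
    by (simp add: upd case_prod_unfold)
  also have "\<dots> \<longleftrightarrow> (\<exists>x. (\<forall>c\<in>set cs. snd (snd c) v = 0 \<longrightarrow> sign_ok (fst c) (aff_val vs (snd c) x)) \<and>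
     (\<forall>c\<in>set cs. \<forall>d\<in>set cs. 0 < snd (snd c) v \<longrightarrow> snd (snd d) v < 0 \<longrightarrow>
        sign_ok (fst c \<or> fst d) (snd (snd c) v * aff_val vs (snd d) x - snd (snd d) v * aff_val vs (snd c) x)))"
    by (simp only: one_variable[OF finite_set])
  also have "\<dots> \<longleftrightarrow> (\<exists>x. \<forall>(s, l)\<in>set (filter (\<lambda>(s, l). snd l v = 0) cs @
      [(s \<or> t, aff_lin (- snd m v) l (snd l v) m).
         (s, l) \<leftarrow> filter (\<lambda>(s, l). 0 < snd l v) cs,
         (t, m) \<leftarrow> filter (\<lambda>(t, m). snd m v < 0) cs]). sign_ok s (aff_val vs l x))"
  proof -
    have "set (filter (\<lambda>(s, l). snd l v = 0) cs @
      [(s \<or> t, aff_lin (- snd m v) l (snd l v) m).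
         (s, l) \<leftarrow> filter (\<lambda>(s, l). 0 < snd l v) cs,
         (t, m) \<leftarrow> filter (\<lambda>(t, m). snd m v < 0) cs]) =
      {c\<in>set cs. snd (snd c) v = 0} \<union> (\<Union>c\<in>{c\<in>set cs. 0 < snd (snd c) v}.
        (\<lambda>d. (fst c \<or> fst d, aff_lin (- snd (snd d) v) (snd c) (snd (snd c) v) (snd d))) `
          {d\<in>set cs. snd (snd d) v < 0})"
      by (simp add: case_prod_unfold)
    then show ?thesis
      by (simp only: ball_Un ball_UN ball_simps aff_val_lin case_prod_unfold fst_conv snd_conv)
        (simp add: Ball_def imp_conjL)
  qed
  also have "\<dots> \<longleftrightarrow> feasible (v # vs) cs"
    using Cons.prems by (simp only: feasible.simps Cons.IH distinct.simps)
  finally show ?case by simp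
qed

definition sat :: "'v list \<Rightarrow> ('v \<Rightarrow> real) \<Rightarrow> 'v constraint list \<Rightarrow> bool" where
  "sat vs x cs \<longleftrightarrow> (\<forall>(s, l)\<in>set cs. sign_ok s (aff_val vs l x))"

lemma sat_simps [simp]:
  "sat vs x []"
  "sat vs x ((s, l) # C) \<longleftrightarrow> sign_ok s (aff_val vs l x) \<and> sat vs x C"
  "sat vs x (C @ D) \<longleftrightarrow> sat vs x C \<and> sat vs x D"
  by (auto simp: sat_def)

lemma mem_pieces:
  "p \<in> set (pieces (TVar v)) \<longleftrightarrow> p = ([], (0, \<lambda>u. if u = v then 1 else 0))"
  "p \<in> set (pieces (TConst c)) \<longleftrightarrow> p = ([], (c, \<lambda>u. 0))"
  "p \<in> set (pieces (TAdd s t)) \<longleftrightarrow> (\<exists>C l D m. (C, l) \<in> set (pieces s) \<and> (D, m) \<in> set (pieces t) \<and>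
     p = (C @ D, aff_lin 1 l 1 m))"
  "p \<in> set (pieces (TSub s t)) \<longleftrightarrow> (\<exists>C l D m. (C, l) \<in> set (pieces s) \<and> (D, m) \<in> set (pieces t) \<and>
     p = (C @ D, aff_lin 1 l (-1) m))"
  "p \<in> set (pieces (TMax s t)) \<longleftrightarrow> (\<exists>C l D m. (C, l) \<in> set (pieces s) \<and> (D, m) \<in> set (pieces t) \<and>
     (p = ((False, aff_lin 1 l (-1) m) # C @ D, l) \<or> p = ((False, aff_lin 1 m (-1) l) # C @ D, m)))"
  "p \<in> set (pieces (TMin s t)) \<longleftrightarrow> (\<exists>C l D m. (C, l) \<in> set (pieces s) \<and> (D, m) \<in> set (pieces t) \<and>
     (p = ((False, aff_lin 1 m (-1) l) # C @ D, l) \<or> p = ((False, aff_lin 1 l (-1) m) # C @ D, m)))"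
  "p \<in> set (pieces (TMul k t)) \<longleftrightarrow> (\<exists>C l. (C, l) \<in> set (pieces t) \<and> p = (C, aff_lin (of_int k) l 0 l))"
  by (simp_all add: Bex_def image_iff split_paired_Ex[where 'a = "'v constraint list" and 'b = "'v affine_fun"] del: split_paired_Ex) blast+

lemma pieces_cover: "\<exists>C l. (C, l) \<in> set (pieces t) \<and> sat vs x C"
proof (induction t)
  case (TMax s t)
  then obtain C l D m where *: "(C, l) \<in> set (pieces s)" "(D, m) \<in> set (pieces t)"
    "sat vs x C" "sat vs x D" by metis
  show ?case
  proof (cases "aff_val vs m x \<le> aff_val vs l x")
    case True
    then have "sat vs x ((False, aff_lin 1 l (-1) m) # C @ D)"
      using * by (simp add: sign_ok_def aff_val_lin)
    then show ?thesis using * unfolding mem_pieces by blast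
  next
    case False
    then have "sat vs x ((False, aff_lin 1 m (-1) l) # C @ D)"
      using * by (simp add: sign_ok_def aff_val_lin)
    then show ?thesis using * unfolding mem_pieces by blast
  qed
next
  case (TMin s t)
  then obtain C l D m where *: "(C, l) \<in> set (pieces s)" "(D, m) \<in> set (pieces t)"
    "sat vs x C" "sat vs x D" by metis
  show ?case
  proof (cases "aff_val vs l x \<le> aff_val vs m x")
    case True
    then have "sat vs x ((False, aff_lin 1 m (-1) l) # C @ D)"
      using * by (simp add: sign_ok_def aff_val_lin)
    then show ?thesis using * unfolding mem_pieces by blast
  next
    case False
    then have "sat vs x ((False, aff_lin 1 l (-1) m) # C @ D)"
      using * by (simp add: sign_ok_def aff_val_lin)
    then show ?thesis using * unfolding mem_pieces by blast
  qed
next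
  case (TAdd s t)
  then show ?case unfolding mem_pieces by (metis sat_simps(3))
next
  case (TSub s t)
  then show ?case unfolding mem_pieces by (metis sat_simps(3))
next
  case (TMul k t)
  then show ?case unfolding mem_pieces by blast
qed simp_all

lemma pieces_val:
  assumes "distinct vs" "texp_vars t \<subseteq> set vs" "(C, l) \<in> set (pieces t)"
    "sat vs x C"
  shows "teval t x = aff_val vs l x"
  using assms(2-)
proof (induction t arbitrary: C l)
  case (TVar v)
  have "(\<Sum>u\<leftarrow>vs. (if u = v then 1 else 0) * x u) = x v"
    using assms(1) TVar(1)
    by (subst sum_list_distinct_conv_sum_set) (auto simp: if_distrib[of "\<lambda>a. a * _"] cong: if_cong)
  then show ?case using TVar by (simp add: mem_pieces aff_val_def)
next
  case (TConst k)
  then show ?case by (simp add: mem_pieces aff_val_def)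
next
  case (TAdd s t)
  then obtain C1 l1 C2 l2 where "(C1, l1) \<in> set (pieces s)" "(C2, l2) \<in> set (pieces t)"
    "C = C1 @ C2" "l = aff_lin 1 l1 1 l2"
    using TAdd.prems(2) by (simp only: mem_pieces prod.inject) blast
  then show ?case using TAdd.IH[of C1 l1] TAdd.IH(2)[of C2 l2] TAdd.prems(1,3)
    by (auto simp: aff_val_lin)
next
  case (TSub s t)
  then obtain C1 l1 C2 l2 where "(C1, l1) \<in> set (pieces s)" "(C2, l2) \<in> set (pieces t)"
    "C = C1 @ C2" "l = aff_lin 1 l1 (-1) l2"
    using TSub.prems(2) by (simp only: mem_pieces prod.inject) blast
  then show ?case using TSub.IH[of C1 l1] TSub.IH(2)[of C2 l2] TSub.prems(1,3)
    by (auto simp: aff_val_lin)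
next
  case (TMax s t)
  then obtain C1 l1 C2 l2 where 1: "(C1, l1) \<in> set (pieces s)" "(C2, l2) \<in> set (pieces t)"
    and 2: "C = (False, aff_lin 1 l1 (-1) l2) # C1 @ C2 \<and> l = l1 \<or>
            C = (False, aff_lin 1 l2 (-1) l1) # C1 @ C2 \<and> l = l2"
    using TMax.prems(2) by (simp only: mem_pieces prod.inject) blast
  from 2 have "sat vs x C1" "sat vs x C2"
    using TMax.prems(3) by auto
  then have "teval s x = aff_val vs l1 x" "teval t x = aff_val vs l2 x"
    using TMax.IH(1)[OF _ 1(1)] TMax.IH(2)[OF _ 1(2)] TMax.prems(1) by auto
  then show ?case using 2 TMax.prems(3) by (auto simp: aff_val_lin sign_ok_def)
next
  case (TMin s t)
  then obtain C1 l1 C2 l2 where 1: "(C1, l1) \<in> set (pieces s)" "(C2, l2) \<in> set (pieces t)"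
    and 2: "C = (False, aff_lin 1 l2 (-1) l1) # C1 @ C2 \<and> l = l1 \<or>
            C = (False, aff_lin 1 l1 (-1) l2) # C1 @ C2 \<and> l = l2"
    using TMin.prems(2) by (simp only: mem_pieces prod.inject) blast
  from 2 have "sat vs x C1" "sat vs x C2"
    using TMin.prems(3) by auto
  then have "teval s x = aff_val vs l1 x" "teval t x = aff_val vs l2 x"
    using TMin.IH(1)[OF _ 1(1)] TMin.IH(2)[OF _ 1(2)] TMin.prems(1) by auto
  then show ?case using 2 TMin.prems(3) by (auto simp: aff_val_lin sign_ok_def)
next
  case (TMul k t)
  then show ?case by (auto simp: mem_pieces aff_val_lin)
qed

lemma feasible_sat: "distinct vs \<Longrightarrow> feasible vs cs \<longleftrightarrow> (\<exists>x. sat vs x cs)"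
  by (simp add: feasible_iff sat_def)

lemma vanishes_iff:
  assumes "distinct vs" "texp_vars t \<subseteq> set vs"
  shows "vanishes vs t \<longleftrightarrow> (\<forall>x. teval t x = 0)"
proof
  assume van: "vanishes vs t"
  show "\<forall>x. teval t x = 0"
  proof
    fix x
    obtain C l where C: "(C, l) \<in> set (pieces t)" "sat vs x C"
      using pieces_cover[of t vs x] by auto
    have "\<not> feasible vs ((True, l) # C)" "\<not> feasible vs ((True, aff_lin (-1) l 0 l) # C)"
      using van C unfolding vanishes_def by auto
    then have "\<not> 0 < aff_val vs l x" "\<not> 0 < - aff_val vs l x"
      using C(2) assms(1) by (auto simp: feasible_sat sign_ok_def aff_val_lin)
    then show "teval t x = 0" using pieces_val[OF assms C] by simp
  qed
next
  assume zero: "\<forall>x. teval t x = 0"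
  show "vanishes vs t"
    unfolding vanishes_def
  proof safe
    fix C k a assume C: "(C, k, a) \<in> set (pieces t)"
    { assume "feasible vs ((True, k, a) # C)"
      then obtain x where "0 < aff_val vs (k, a) x" "sat vs x C"
        using assms(1) by (auto simp: feasible_sat sign_ok_def)
      then show False using pieces_val[OF assms C] zero by auto }
    { assume "feasible vs ((True, aff_lin (-1) (k, a) 0 (k, a)) # C)"
      then obtain x where "0 < - aff_val vs (k, a) x" "sat vs x C"
        using assms(1) by (auto simp: feasible_sat sign_ok_def aff_val_lin)
      then show False using pieces_val[OF assms C] zero by auto }
  qed
qed

lemma teval_tsubst: "teval (tsubst \<theta> t) x = teval t (\<lambda>v. teval (\<theta> v) x)"
  by (induction t) auto

lemma texp_vars_tsubst: "texp_vars (tsubst \<theta> t) = (\<Union>v\<in>texp_vars t. texp_vars (\<theta> v))"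
  by (induction t) auto

lemma teval_cong: "(\<And>v. v \<in> texp_vars t \<Longrightarrow> x v = y v) \<Longrightarrow> teval t x = teval t y"
  by (induction t) auto

lemma teval_tsum_list: "teval (tsum_list ts) x = (\<Sum>t\<leftarrow>ts. teval t x)"
  by (induction ts) (auto simp: tsum_list_def)

lemma texp_vars_tsum_list: "texp_vars (tsum_list ts) = (\<Union>t\<in>set ts. texp_vars t)"
  by (induction ts) (auto simp: tsum_list_def)

lemma teval_tmax_list: "ts \<noteq> [] \<Longrightarrow> teval (tmax_list ts) x = Max ((\<lambda>t. teval t x) ` set ts)"
  by (induction ts rule: tmax_list.induct) auto

lemma texp_vars_tmax_list: "texp_vars (tmax_list ts) = (\<Union>t\<in>set ts. texp_vars t)"
  by (induction ts rule: tmax_list.induct) auto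

lemma mem_families: "Is \<in> set (families n r c) \<longleftrightarrow> length Is = r \<and>
    set Is \<subseteq> set (subseqs [1..<Suc n]) \<and> (\<forall>\<alpha>\<in>{1..r}. length (Is ! (\<alpha> - 1)) = c \<alpha>) \<and>
    disjoint_family_on (\<lambda>\<alpha>. set (Is ! (\<alpha> - 1))) {1..r}"
  by (auto simp: families_def set_n_lists simp del: upt_Suc)

lemma families_nth:
  assumes "Is \<in> set (families n r c)" "\<alpha> \<in> {1..r}"
  shows "Is ! (\<alpha> - 1) \<in> set (subseqs [1..<Suc n])"
proof -
  have "\<alpha> - 1 < length Is" "set Is \<subseteq> set (subseqs [1..<Suc n])"
    using assms unfolding mem_families by auto
  then show ?thesis using nth_mem by blast
qed

lemma mem_subseqs_upt:
  assumes "xs \<in> set (subseqs [1..<Suc n])"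
  shows "distinct xs" "set xs \<subseteq> {1..n}"
proof -
  show "distinct xs" using subseqs_distinctD[OF assms] by simp
  have "set xs \<in> Pow (set [1..<Suc n])" using assms subseqs_powset[of "[1..<Suc n]"] by blast
  then show "set xs \<subseteq> {1..n}" by (auto simp del: upt_Suc)
qed

lemma b_expr_correct:
  assumes "c \<in> Idx n r"
  shows "teval (b_expr n r c m) x = b n r c (\<lambda>p. teval (m p) x)"
proof -
  define adm where "adm I \<longleftrightarrow> (\<forall>\<alpha>\<in>{1..r}. I \<alpha> \<subseteq> {1..n} \<and> card (I \<alpha>) = c \<alpha>) \<and> disjoint_family_on I {1..r}"
    for I :: "nat \<Rightarrow> nat set"
  define val where "val I = (\<Sum>\<alpha>=1..r. \<Sum>i\<in>I \<alpha>. teval (m (i, \<alpha>)) x)" for I :: "nat \<Rightarrow> nat set"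
  define fam where "fam Is = (\<lambda>\<alpha>. set (Is ! (\<alpha> - 1)))" for Is :: "nat list list"
  note sub = mem_subseqs_upt and nth = families_nth
  have sc: "sum_list (concat xss) = sum_list (map sum_list xss)" for xss :: "real list list"
    by (induction xss) auto
  have val: "teval (tsum_list [m (i, \<alpha>). \<alpha> \<leftarrow> [1..<Suc r], i \<leftarrow> Is ! (\<alpha> - 1)]) x = val (fam Is)"
    if "Is \<in> set (families n r c)" for Is
  proof -
    have "(\<Sum>i\<leftarrow>Is ! (\<alpha> - 1). teval (m (i, \<alpha>)) x) = (\<Sum>i\<in>fam Is \<alpha>. teval (m (i, \<alpha>)) x)"
      if "\<alpha> \<in> {1..r}" for \<alpha>
      using sub(1)[OF nth[OF \<open>Is \<in> _\<close> that]] by (simp add: fam_def sum_list_distinct_conv_sum_set)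
    moreover have "teval (tsum_list [m (i, \<alpha>). \<alpha> \<leftarrow> [1..<Suc r], i \<leftarrow> Is ! (\<alpha> - 1)]) x
        = (\<Sum>\<alpha>\<leftarrow>[1..<Suc r]. \<Sum>i\<leftarrow>Is ! (\<alpha> - 1). teval (m (i, \<alpha>)) x)"
      by (simp add: teval_tsum_list map_concat sc comp_def del: upt_Suc)
    ultimately show ?thesis
      by (simp add: val_def sum_list_distinct_conv_sum_set atLeastLessThanSuc_atLeastAtMost
          del: upt_Suc)
  qed
  have fam_adm: "adm (fam Is)" if "Is \<in> set (families n r c)" for Is
  proof -
    have "fam Is \<alpha> \<subseteq> {1..n} \<and> card (fam Is \<alpha>) = c \<alpha>" if "\<alpha> \<in> {1..r}" for \<alpha>
      using sub[OF nth[OF \<open>Is \<in> _\<close> that]] \<open>Is \<in> _\<close> that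
      unfolding mem_families fam_def by (simp add: distinct_card)
    then show ?thesis using that unfolding mem_families adm_def fam_def by blast
  qed
  have surj: "\<exists>Is\<in>set (families n r c). val (fam Is) = val I" if "adm I" for I
  proof -
    have "\<exists>xs\<in>set (subseqs [1..<Suc n]). set xs = I \<alpha>" if "\<alpha> \<in> {1..r}" for \<alpha>
    proof -
      have "I \<alpha> \<in> set ` set (subseqs [1..<Suc n])"
        using \<open>adm I\<close> that unfolding subseqs_powset adm_def set_upt
          by (metis PowI atLeastLessThanSuc_atLeastAtMost)
      then show ?thesis by auto
    qed
    then obtain h where h: "\<And>\<alpha>. \<alpha> \<in> {1..r} \<Longrightarrow> h \<alpha> \<in> set (subseqs [1..<Suc n]) \<and> set (h \<alpha>) = I \<alpha>"
      by metis
    define Is where "Is = map h [1..<Suc r]"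
    have nth': "Is ! (\<alpha> - 1) = h \<alpha>" if "\<alpha> \<in> {1..r}" for \<alpha>
      using that by (auto simp: Is_def simp del: upt_Suc)
    have "length (h \<alpha>) = c \<alpha>" if "\<alpha> \<in> {1..r}" for \<alpha>
      using h[OF that] sub(1) distinct_card that \<open>adm I\<close> by (metis adm_def)
    moreover have "disjoint_family_on (\<lambda>\<alpha>. set (Is ! (\<alpha> - 1))) {1..r}"
      using \<open>adm I\<close> h nth' by (simp add: adm_def disjoint_family_on_def)
    ultimately have "Is \<in> set (families n r c)"
      using h nth' unfolding mem_families by (auto simp: Is_def simp del: upt_Suc)
    moreover have "val (fam Is) = val I"
    proof -
      have "fam Is \<alpha> = I \<alpha>" if "\<alpha> \<in> {1..r}" for \<alpha>
        using h[OF that] nth'[OF that] by (simp add: fam_def)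
      then show ?thesis unfolding val_def by (intro sum.cong) auto
    qed
    ultimately show ?thesis by blast
  qed
  have eq: "(\<lambda>Is. val (fam Is)) ` set (families n r c) = {val I | I. adm I}"
    using fam_adm surj by force
  have "families n r c \<noteq> []"
  proof -
    define S where "S \<alpha> = (\<Sum>\<beta>=1..<\<alpha>. c \<beta>)" for \<alpha>
    define I where "I \<alpha> = {S \<alpha><..S (Suc \<alpha>)}" for \<alpha>
    have Suc: "S (Suc \<alpha>) = S \<alpha> + c \<alpha>" if "1 \<le> \<alpha>" for \<alpha> using that by (simp add: S_def)
    have mono: "S \<alpha> \<le> S \<beta>" if "\<alpha> \<le> \<beta>" for \<alpha> \<beta>
      unfolding S_def using that by (intro sum_mono2) auto
    have "S (Suc r) \<le> n" using assms by (simp add: S_def Idx_def atLeastLessThanSuc_atLeastAtMost)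
    then have "I \<alpha> \<subseteq> {1..n}" if "\<alpha> \<in> {1..r}" for \<alpha>
      using mono[of "Suc \<alpha>" "Suc r"] that by (auto simp: I_def)
    moreover have "card (I \<alpha>) = c \<alpha>" if "\<alpha> \<in> {1..r}" for \<alpha>
      using that by (simp add: I_def Suc)
    moreover have "I \<alpha> \<inter> I \<beta> = {}" if "\<alpha> < \<beta>" for \<alpha> \<beta>
      using mono[of "Suc \<alpha>" \<beta>] that by (auto simp: I_def)
    then have "disjoint_family_on I {1..r}"
      unfolding disjoint_family_on_def by (metis Int_commute linorder_neqE_nat)
    ultimately have "adm I" by (simp add: adm_def)
    then show ?thesis using surj by fastforce
  qed
  then have "teval (b_expr n r c m) x = Max ((\<lambda>Is. val (fam Is)) ` set (families n r c))"
    unfolding b_expr_def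
    by (subst teval_tmax_list)
      (simp, simp only: set_map image_image, intro arg_cong[where f = Max] image_cong refl val)
  moreover have "c \<noteq> (\<lambda>_. 0)" using assms by (auto simp: Idx_def)
  ultimately show ?thesis
    unfolding eq b_def by (simp add: val_def adm_def)
qed

lemma texp_vars_b_expr: "texp_vars (b_expr n r c TVar) \<subseteq> set (entries n r)"
proof -
  have "i \<in> {1..n}" if "Is \<in> set (families n r c)" "\<alpha> \<in> {1..r}" "i \<in> set (Is ! (\<alpha> - 1))" for Is \<alpha> i
    using mem_subseqs_upt(2)[OF families_nth[OF that(1,2)]] that(3) by blast
  then show ?thesis
    by (fastforce simp: b_expr_def texp_vars_tmax_list texp_vars_tsum_list entries_def simp del: upt_Suc)
qed

lemma identity_test_iff:
  assumes "texp_vars g \<subseteq> Idx n r" and "texp_vars f \<subseteq> set (entries n r)"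
  shows "identity_test n r g f \<longleftrightarrow> (\<forall>M. teval g (Phi n r M) = teval f M)"
proof -
  have "teval (tsubst (\<lambda>c. b_expr n r c TVar) g) M = teval g (Phi n r M)" for M
    unfolding teval_tsubst using assms(1) by (intro teval_cong) (auto simp: b_expr_correct Phi_def)
  moreover have "distinct (entries n r)"
    by (simp add: entries_def distinct_product)
  moreover have "texp_vars (TSub (tsubst (\<lambda>c. b_expr n r c TVar) g) f) \<subseteq> set (entries n r)"
    using assms(2) texp_vars_b_expr by (fastforce simp: texp_vars_tsubst)
  ultimately show ?thesis
    unfolding identity_test_def by (simp add: vanishes_iff)
qed

section \<open>The algorithm\<close>

text \<open>
  The first argument after the dimensions is the explicit constant, if one is available.
  The result is \<open>None\<close> iff the search for \<open>\<kappa>\<close> does not terminate.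
\<close>

definition algorithm ::
    "nat \<Rightarrow> nat \<Rightarrow> real option \<Rightarrow> trop_poly \<Rightarrow> trop_poly \<Rightarrow> index texp option" where
  "algorithm n r c0_opt P Q = (case c0_opt of
     Some c0 \<Rightarrow> Some (g_expr n r P Q
       \<lceil>real (Lip_bound n r P Q) * sqrt (real ((n + r choose r) - 1)) / c0\<rceil>)
   | None \<Rightarrow> map_option (g_expr n r P Q)
       (while_option (\<lambda>\<kappa>. \<not> identity_test n r (g_expr n r P Q \<kappa>) (input_expr n r P Q))
         (\<lambda>\<kappa>. 2 * \<kappa>) 1))"

end

theory Submission
  imports Defs
begin

text \<open>
  The coordinates \<open>w\<^bsub>k e\<^sub>\<alpha>\<^esub>\<close> of \<open>w = \<Phi>(M)\<close> are the sums of the \<open>k\<close> largest entries of column \<open>\<alpha>\<close>, so their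
  differences recover every column of \<open>M\<close> up to order (\<open>b_pure\<close>, \<open>teval_M_hat\<close>). What is lost is how
  the columns are coupled into rows. The algorithm tries all couplings: for each tuple of permutations
  it evaluates \<open>f\<close> at the reconstructed matrix \<open>N\<close> and adds \<open>\<kappa>\<close> times the largest mismatch of the mixed
  coordinates of \<open>\<Phi>(N)\<close> with those of \<open>w\<close>. The true coupling has no mismatch and gives \<open>f(M)\<close>. For a
  wrong coupling, a lower Lipschitz bound for \<open>\<Phi>\<close> on orbits keeps the distance from \<open>N\<close> to the orbit
  of \<open>M\<close> below a constant times the mismatch, and \<open>f\<close> is invariant and Lipschitz; hence for large \<open>\<kappa>\<close> the penalty
  outweighs the error, and the minimum is \<open>f(M)\<close> (\<open>invariant_Lipschitz\<close>, \<open>g_expr_correct\<close>).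

  The search for \<open>\<kappa>\<close> terminates because some lower Lipschitz constant exists
  (\<open>lower_Lipschitz_const_exists\<close>). The numbers \<open>b\<^sub>c(M)\<close> are the coefficients of a tropical product of
  linear forms, one for each row: for \<open>t \<in> \<real>\<^sup>r\<close>,
  \<open>\<Sum>\<^sub>i max(0, max\<^sub>\<alpha> (t\<^sub>\<alpha> + m\<^bsub>i\<alpha>\<^esub>)) = max\<^sub>c (b\<^sub>c(M) + \<langle>c, t\<rangle>)\<close>, where \<open>c = 0\<close> is included. Therefore,
  if all \<open>b\<^sub>c(M)\<close> and \<open>b\<^sub>c(N)\<close> differ by at most \<open>\<delta>\<close>, so do these functions of \<open>t\<close>
  (\<open>tropical_product_le\<close>). A mixed difference over all coordinate directions, that of the constant 0 included, turns the summand of a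
  row into a tent supported near the negative of that row (\<open>alternating_sum_Max\<close>), so every row of \<open>M\<close>
  has a row of \<open>N\<close> within a constant multiple of \<open>\<delta>\<close> (\<open>close_row\<close>). Removing such pairs one after another
  yields a matching of the rows (\<open>row_matching\<close>).
\<close>

section \<open>Alternating sums of maxima\<close>

lemma Max_image_le:
  fixes f g :: "_ \<Rightarrow> real"
  assumes "finite A" "A \<noteq> {}" "\<And>a. a \<in> A \<Longrightarrow> \<exists>b\<in>A. f a \<le> g b"
  shows "Max (f ` A) \<le> Max (g ` A)"
proof (subst Max_le_iff)
  show "\<forall>x\<in>f ` A. x \<le> Max (g ` A)"
  proof
    fix x assume "x \<in> f ` A"
    then obtain a b where "b \<in> A" "x \<le> g b" using assms(3) by blast
    then show "x \<le> Max (g ` A)" using assms(1) by (meson Max_ge finite_imageI imageI order_trans)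
  qed
qed (use assms in auto)

text \<open>
  On vectors that vanish at a base point this is a norm, and it is equivalent to the maximum norm.
\<close>

definition spread :: "'a set \<Rightarrow> ('a \<Rightarrow> real) \<Rightarrow> real" where
  "spread A u = Max (u ` A) - Min (u ` A)"

lemma spread_ge_diff:
  assumes "finite A" "a \<in> A" "z \<in> A"
  shows "\<bar>u a - u z\<bar> \<le> spread A u"
proof -
  have "u a \<le> Max (u ` A)" "u z \<le> Max (u ` A)" "Min (u ` A) \<le> u a" "Min (u ` A) \<le> u z"
    using assms by auto
  then show ?thesis unfolding spread_def by linarith
qed

text \<open>
  Up to sign, the sum is a mixed difference, with one step of length \<open>\<epsilon>\<close> in each coordinate direction, of the
  function \<open>u \<mapsto> max u\<close>. It sees only the points where all coordinates nearly tie: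
  if \<open>j\<close> minimises \<open>u\<close>, then raising coordinate \<open>j\<close> by \<open>\<epsilon>\<close> changes nothing once another coordinate
  has been raised, so the terms for \<open>T\<close> and \<open>insert j T\<close> cancel unless \<open>T\<close> is empty. The two
  remaining terms give minus a tent of height \<open>\<epsilon>\<close>.
\<close>

lemma alternating_sum_Max:
  fixes u :: "'a \<Rightarrow> real"
  assumes "finite A" "A \<noteq> {}" "0 \<le> \<epsilon>"
  shows "(\<Sum>T\<in>Pow A. (-1) ^ card T * Max ((\<lambda>a. u a + (if a \<in> T then \<epsilon> else 0)) ` A))
    = - max 0 (\<epsilon> - spread A u)"
proof -
  define G where "G T = Max ((\<lambda>a. u a + (if a \<in> T then \<epsilon> else 0)) ` A)" for T
  have "Min (u ` A) \<in> u ` A" using assms by (intro Min_in) auto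
  then obtain j where j: "j \<in> A" "u j = Min (u ` A)" by auto
  have jmin: "u j \<le> u a" if "a \<in> A" for a using that j assms(1) by simp
  define B where "B = A - {j}"
  have B: "A = insert j B" "j \<notin> B" "finite B" using j assms(1) by (auto simp: B_def)
  have mono: "G T \<le> G T'" if "T \<subseteq> T'" for T T'
    unfolding G_def
  proof (intro Max_image_le assms(1,2))
    fix a assume "a \<in> A"
    then show "\<exists>b\<in>A. u a + (if a \<in> T then \<epsilon> else 0) \<le> u b + (if b \<in> T' then \<epsilon> else 0)"
      using assms(3) that by (intro bexI[of _ a]) auto
  qed
  have absorb: "G (insert j T) = G T" if T: "T \<subseteq> B" "T \<noteq> {}" for T
  proof (rule antisym)
    show "G T \<le> G (insert j T)" by (intro mono) blast
    obtain k where k: "k \<in> T" using T by blast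
    show "G (insert j T) \<le> G T"
      unfolding G_def
    proof (intro Max_image_le assms(1,2))
      fix a assume a: "a \<in> A"
      show "\<exists>b\<in>A. u a + (if a \<in> insert j T then \<epsilon> else 0) \<le> u b + (if b \<in> T then \<epsilon> else 0)"
      proof (cases "a = j")
        case True
        have "k \<in> A" using k T B by blast
        then show ?thesis using k jmin[of k] True by (intro bexI[of _ k]) auto
      next
        case False
        then show ?thesis using a by (intro bexI[of _ a]) auto
      qed
    qed
  qed
  have G0: "G {} = Max (u ` A)" by (simp add: G_def)
  have Gj: "G {j} = max (Max (u ` A)) (u j + \<epsilon>)"
  proof (rule antisym)
    have "u a + (if a \<in> {j} then \<epsilon> else 0) \<le> max (Max (u ` A)) (u j + \<epsilon>)" if "a \<in> A" for a
      using that assms(1) by (auto simp: le_max_iff_disj)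
    then show "G {j} \<le> max (Max (u ` A)) (u j + \<epsilon>)"
      unfolding G_def using assms by (subst Max_le_iff) auto
    have "G {} \<le> G {j}" by (intro mono) blast
    moreover have "u j + \<epsilon> \<in> (\<lambda>a. u a + (if a \<in> {j} then \<epsilon> else 0)) ` A"
      using j(1) by (intro image_eqI[of _ _ j]) auto
    then have "u j + \<epsilon> \<le> G {j}"
      unfolding G_def using assms(1) by (intro Max_ge) auto
    ultimately show "max (Max (u ` A)) (u j + \<epsilon>) \<le> G {j}" using G0 by simp
  qed
  have inj: "inj_on (insert j) (Pow B)" using B(2) by (auto simp: inj_on_def)
  have "(\<Sum>T\<in>Pow A. (-1) ^ card T * G T)
      = (\<Sum>T\<in>Pow B. (-1) ^ card T * G T) + (\<Sum>T\<in>insert j ` Pow B. (-1) ^ card T * G T)"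
    unfolding B(1) Pow_insert using B(2,3) by (intro sum.union_disjoint) auto
  also have "(\<Sum>T\<in>insert j ` Pow B. (-1) ^ card T * G T)
      = (\<Sum>T\<in>Pow B. (-1) ^ card (insert j T) * G (insert j T))"
    using inj by (simp add: sum.reindex)
  also have "\<dots> = (\<Sum>T\<in>Pow B. - ((-1) ^ card T * G (insert j T)))"
  proof (intro sum.cong refl)
    fix T assume "T \<in> Pow B"
    then have "finite T" "j \<notin> T" using B(2,3) finite_subset by auto
    then show "(-1) ^ card (insert j T) * G (insert j T) = - ((-1) ^ card T * G (insert j T))" by simp
  qed
  also have "(\<Sum>T\<in>Pow B. (-1) ^ card T * G T) + \<dots>
      = (\<Sum>T\<in>Pow B. (-1) ^ card T * (G T - G (insert j T)))"
    by (simp add: sum_negf right_diff_distrib sum_subtractf)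
  also have "\<dots> = (\<Sum>T\<in>{{}}. (-1) ^ card T * (G T - G (insert j T)))"
    using B(3) absorb by (intro sum.mono_neutral_right) auto
  also have "\<dots> = - max 0 (\<epsilon> - spread A u)"
    unfolding spread_def j(2)[symmetric] using G0 Gj by (simp add: max_def)
  finally show ?thesis unfolding G_def .
qed

section \<open>Recovering rows from a sum of maxima\<close>

text \<open>
  Apply the alternating sum to the difference of the two sums, centred at the row \<open>m i\<close>. Each sum of
  maxima turns into a sum of tents around \<open>m i\<close>, and the difference of these is at most
  \<open>2 ^ card A * \<delta>\<close>. If \<open>\<epsilon>\<close> is the distance, in terms of the spread, from \<open>m i\<close> to the nearest row of \<open>m'\<close>, then all tents of
  \<open>m'\<close> vanish there while the tent of \<open>m i\<close> itself contributes \<open>\<epsilon>\<close>.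
\<close>

lemma close_row:
  fixes m :: "'i \<Rightarrow> 'a \<Rightarrow> real" and m' :: "'j \<Rightarrow> 'a \<Rightarrow> real"
  assumes A: "finite A" "A \<noteq> {}" and "finite I" "i \<in> I" "finite J" "J \<noteq> {}"
    and close: "\<And>t. \<bar>(\<Sum>i\<in>I. Max ((\<lambda>a. t a + m i a) ` A)) - (\<Sum>j\<in>J. Max ((\<lambda>a. t a + m' j a) ` A))\<bar> \<le> \<delta>"
  shows "\<exists>j\<in>J. spread A (\<lambda>a. m' j a - m i a) \<le> 2 ^ card A * \<delta>"
proof -
  define S where "S = (\<lambda>j. spread A (\<lambda>a. m' j a - m i a)) ` J"
  have "Min S \<in> S" unfolding S_def using assms by (intro Min_in) auto
  then obtain j where j: "j \<in> J" "spread A (\<lambda>a. m' j a - m i a) = Min S" by (auto simp: S_def)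
  define \<epsilon> where "\<epsilon> = Min S"
  have jmin: "\<epsilon> \<le> spread A (\<lambda>a. m' k a - m i a)" if "k \<in> J" for k
    unfolding \<epsilon>_def using that assms(5) by (auto simp: S_def)
  obtain z where "z \<in> A" using A by blast
  then have "0 \<le> \<epsilon>"
    using spread_ge_diff[OF A(1), of z z] j(2) by (simp add: \<epsilon>_def) (metis abs_zero diff_self)
  \<comment> \<open>Subtracting \<open>m i\<close> centres the tents at this row.\<close>
  define t where "t T a = (if a \<in> T then \<epsilon> else 0) - m i a" for T a
  define tent where "tent v = max 0 (\<epsilon> - spread A (\<lambda>a. v a - m i a))" for v
  have tent: "(\<Sum>T\<in>Pow A. (-1) ^ card T * Max ((\<lambda>a. t T a + v a) ` A)) = - tent v" for v
    using alternating_sum_Max[OF A \<open>0 \<le> \<epsilon>\<close>, of "\<lambda>a. v a - m i a"]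
    by (simp add: tent_def t_def algebra_simps)
  define F where "F T = (\<Sum>i\<in>I. Max ((\<lambda>a. t T a + m i a) ` A)) - (\<Sum>j\<in>J. Max ((\<lambda>a. t T a + m' j a) ` A))" for T
  have "(\<Sum>j\<in>J. tent (m' j)) - (\<Sum>k\<in>I. tent (m k)) = (\<Sum>T\<in>Pow A. (-1) ^ card T * F T)"
    unfolding F_def right_diff_distrib sum_subtractf sum_distrib_left
    by (subst (1 2) sum.swap) (simp add: tent sum_negf)
  also have "\<bar>\<dots>\<bar> \<le> (\<Sum>T\<in>Pow A. \<delta>)"
    using close by (intro order_trans[OF sum_abs] sum_mono) (auto simp: abs_mult F_def)
  also have "\<dots> = 2 ^ card A * \<delta>" using A(1) by (simp add: card_Pow)
  finally have "\<bar>(\<Sum>j\<in>J. tent (m' j)) - (\<Sum>k\<in>I. tent (m k))\<bar> \<le> 2 ^ card A * \<delta>" .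
  moreover have "(\<Sum>j\<in>J. tent (m' j)) = 0"
    by (intro sum.neutral ballI) (simp add: tent_def max_absorb1 jmin)
  moreover have "tent (m i) = \<epsilon>"
    using A \<open>0 \<le> \<epsilon>\<close> by (auto simp: tent_def spread_def image_constant_conv)
  moreover have "tent (m i) \<le> (\<Sum>k\<in>I. tent (m k))"
    using assms by (intro member_le_sum) (auto simp: tent_def)
  ultimately have "\<epsilon> \<le> 2 ^ card A * \<delta>" by linarith
  then have "spread A (\<lambda>a. m' j a - m i a) \<le> 2 ^ card A * \<delta>" using j(2) by (simp add: \<epsilon>_def)
  then show ?thesis using j(1) by blast
qed

lemma Max_image_diff_le:
  fixes f g :: "'a \<Rightarrow> real"
  assumes "finite A" "A \<noteq> {}" "\<And>a. a \<in> A \<Longrightarrow> \<bar>f a - g a\<bar> \<le> d"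
  shows "\<bar>Max (f ` A) - Max (g ` A)\<bar> \<le> d"
proof -
  have *: "Max (f ` A) \<le> Max (g ` A) + d" if "\<And>a. a \<in> A \<Longrightarrow> f a \<le> g a + d" for f g
  proof (subst Max_le_iff)
    show "\<forall>x\<in>f ` A. x \<le> Max (g ` A) + d"
    proof
      fix x assume "x \<in> f ` A"
      then obtain a where a: "a \<in> A" "x = f a" by blast
      then have "g a \<le> Max (g ` A)" using assms(1) by auto
      then show "x \<le> Max (g ` A) + d" using a that[OF a(1)] by linarith
    qed
  qed (use assms in auto)
  have "f a \<le> g a + d" "g a \<le> f a + d" if "a \<in> A" for a
    using assms(3)[OF that] by linarith+
  then show ?thesis using *[of f g] *[of g f] by fastforce
qed

text \<open>
  Pair a row of \<open>m\<close> with a close row of \<open>m'\<close> and remove both. The two sums of maxima over the remaining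
  rows still agree up to a constant multiple of \<open>\<delta>\<close>, so the pairing can be continued; the
  error grows by the factor \<open>1 + 2 ^ card A\<close> in each step. The base coordinate \<open>z\<close>, where all rows
  vanish, is what makes the spread of a difference bound its entries: without it the rows would be
  determined only up to a common additive constant.
\<close>

lemma row_matching:
  fixes m :: "'i \<Rightarrow> 'a \<Rightarrow> real" and m' :: "'j \<Rightarrow> 'a \<Rightarrow> real"
  assumes A: "finite A" "z \<in> A" and "finite I" "finite J" "card I = card J"
    and "\<And>i. i \<in> I \<Longrightarrow> m i z = 0" "\<And>j. j \<in> J \<Longrightarrow> m' j z = 0"
    and "\<And>t. \<bar>(\<Sum>i\<in>I. Max ((\<lambda>a. t a + m i a) ` A)) - (\<Sum>j\<in>J. Max ((\<lambda>a. t a + m' j a) ` A))\<bar> \<le> \<delta>"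
  shows "\<exists>\<pi>. bij_betw \<pi> I J \<and> (\<forall>i\<in>I. \<forall>a\<in>A. \<bar>m i a - m' (\<pi> i) a\<bar> \<le> (1 + 2 ^ card A) ^ card I * \<delta>)"
  using assms(3-)
proof (induction I arbitrary: J \<delta> rule: finite_induct)
  case empty
  then show ?case by (auto simp: bij_betw_def)
next
  case (insert i I)
  define C where "C = 1 + 2 ^ card A * (1::real)"
  have ne: "A \<noteq> {}" using A by blast
  have "J \<noteq> {}" using insert by auto
  then obtain j where j: "j \<in> J" "spread A (\<lambda>a. m' j a - m i a) \<le> 2 ^ card A * \<delta>"
    using close_row[OF A(1) ne _ _ _ _ insert.prems(5), of i] insert.hyps(1) insert.prems(1) by auto
  have near: "\<bar>m i a - m' j a\<bar> \<le> 2 ^ card A * \<delta>" if "a \<in> A" for a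
    using spread_ge_diff[OF A(1) that A(2), of "\<lambda>a. m' j a - m i a"] j insert.prems(3)[of i]
      insert.prems(4)[OF j(1)] by simp
  have "0 \<le> \<delta>" using insert.prems(5)[of undefined] by linarith
  define J' where "J' = J - {j}"
  have J: "J = insert j J'" "j \<notin> J'" "finite J'" using j insert.prems(1) by (auto simp: J'_def)
  have "\<exists>\<pi>. bij_betw \<pi> I J' \<and> (\<forall>i\<in>I. \<forall>a\<in>A. \<bar>m i a - m' (\<pi> i) a\<bar> \<le> (1 + 2 ^ card A) ^ card I * (C * \<delta>))"
  proof (rule insert.IH)
    fix t
    have "\<bar>Max ((\<lambda>a. t a + m i a) ` A) - Max ((\<lambda>a. t a + m' j a) ` A)\<bar> \<le> 2 ^ card A * \<delta>"
      using A(1) ne near by (intro Max_image_diff_le) auto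
    moreover have "\<bar>(Max ((\<lambda>a. t a + m i a) ` A) + (\<Sum>i\<in>I. Max ((\<lambda>a. t a + m i a) ` A)))
        - (Max ((\<lambda>a. t a + m' j a) ` A) + (\<Sum>j\<in>J'. Max ((\<lambda>a. t a + m' j a) ` A)))\<bar> \<le> \<delta>"
      using insert.prems(5)[of t] insert.hyps J by simp
    ultimately show "\<bar>(\<Sum>i\<in>I. Max ((\<lambda>a. t a + m i a) ` A)) - (\<Sum>j\<in>J'. Max ((\<lambda>a. t a + m' j a) ` A))\<bar> \<le> C * \<delta>"
      unfolding C_def by (simp add: algebra_simps)
  qed (use insert.prems insert.hyps J in auto)
  then obtain \<pi> where \<pi>: "bij_betw \<pi> I J'"
    "\<And>k a. k \<in> I \<Longrightarrow> a \<in> A \<Longrightarrow> \<bar>m k a - m' (\<pi> k) a\<bar> \<le> C ^ card I * (C * \<delta>)"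
    by (auto simp: C_def)
  have C1: "C ^ card (insert i I) = C ^ card I * C" using insert.hyps by simp
  have "1 \<le> C" by (simp add: C_def)
  then have "1 * (2 ^ card A * \<delta>) \<le> C ^ card I * (C * \<delta>)"
    using \<open>0 \<le> \<delta>\<close> by (intro mult_mono one_le_power mult_right_mono) (auto simp: C_def)
  then have "\<bar>m i a - m' j a\<bar> \<le> C ^ card I * (C * \<delta>)" if "a \<in> A" for a
    using near[OF that] by linarith
  then have "\<forall>k\<in>insert i I. \<forall>a\<in>A. \<bar>m k a - m' ((\<pi>(i := j)) k) a\<bar> \<le> C ^ card (insert i I) * \<delta>"
    using \<pi>(2) insert.hyps(2) unfolding C1 mult.assoc by auto
  moreover have "bij_betw (\<pi>(i := j)) (insert i I) J"
  proof -
    have "bij_betw (\<pi>(i := j)) I J'"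
      using \<pi>(1) insert.hyps(2) by (subst bij_betw_cong[of _ _ \<pi>]) auto
    then show ?thesis unfolding J(1)
      using insert.hyps(2) J(2) notIn_Un_bij_betw3[of i I "\<pi>(i := j)" J'] by simp
  qed
  ultimately show ?case unfolding C_def by auto
qed

section \<open>The functions \<open>b\<^sub>c\<close> as coefficients of a tropical product\<close>

definition selection :: "nat \<Rightarrow> nat \<Rightarrow> index \<Rightarrow> (nat \<Rightarrow> nat set) \<Rightarrow> bool" where
  "selection n r c I \<longleftrightarrow>
     (\<forall>\<alpha>\<in>{1..r}. I \<alpha> \<subseteq> {1..n} \<and> card (I \<alpha>) = c \<alpha>) \<and> disjoint_family_on I {1..r}"

definition selected_sum :: "nat \<Rightarrow> (entry \<Rightarrow> real) \<Rightarrow> (nat \<Rightarrow> nat set) \<Rightarrow> real" where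
  "selected_sum r M I = (\<Sum>\<alpha>=1..r. \<Sum>i\<in>I \<alpha>. M (i, \<alpha>))"

lemma b_alt: "b n r c M = (if c = (\<lambda>_. 0) then 0 else Max (selected_sum r M ` {I. selection n r c I}))"
proof -
  have "{\<Sum>\<alpha>=1..r. \<Sum>i\<in>I \<alpha>. M (i, \<alpha>) | I. selection n r c I}
      = selected_sum r M ` {I. selection n r c I}"
    unfolding selected_sum_def by blast
  then show ?thesis by (simp add: b_def selection_def)
qed

lemma finite_selected_sums: "finite (selected_sum r M ` {I. selection n r c I})"
proof (rule finite_subset)
  show "selected_sum r M ` {I. selection n r c I} \<subseteq> selected_sum r M ` (PiE {1..r} (\<lambda>_. Pow {1..n}))"
  proof
    fix x assume "x \<in> selected_sum r M ` {I. selection n r c I}"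
    then obtain I where I: "selection n r c I" "x = selected_sum r M I" by blast
    have "selected_sum r M I = selected_sum r M (restrict I {1..r})"
      unfolding selected_sum_def by (intro sum.cong) auto
    moreover have "restrict I {1..r} \<in> PiE {1..r} (\<lambda>_. Pow {1..n})"
      using I(1) by (auto simp: selection_def)
    ultimately show "x \<in> selected_sum r M ` (PiE {1..r} (\<lambda>_. Pow {1..n}))" using I(2) by blast
  qed
  show "finite (selected_sum r M ` (PiE {1..r} (\<lambda>_. Pow {1..n})))"
    by (intro finite_imageI finite_PiE) auto
qed

lemma selection_zero_sum:
  assumes "selection n r (\<lambda>_. 0) I"
  shows "selected_sum r M I = 0"
proof -
  have "I \<alpha> = {}" if "\<alpha> \<in> {1..r}" for \<alpha>
    using assms that unfolding selection_def by (metis card_0_eq finite_atLeastAtMost finite_subset)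
  then show ?thesis unfolding selected_sum_def by (intro sum.neutral) auto
qed

lemma selected_sum_le_b:
  assumes "selection n r c I"
  shows "selected_sum r M I \<le> b n r c M"
  using assms finite_selected_sums[of r M n c] selection_zero_sum[of n r I M]
  by (cases "c = (\<lambda>_. 0)") (auto simp: b_alt intro!: Max_ge)

text \<open>
  Whether a family is a selection depends on \<open>c\<close> alone. A selection found from one
  matrix therefore shows that the maximum for any other matrix is over a nonempty set.
\<close>

lemma b_attained:
  assumes "selection n r c I\<^sub>0"
  shows "\<exists>I. selection n r c I \<and> b n r c M = selected_sum r M I"
proof (cases "c = (\<lambda>_. 0)")
  case True
  then show ?thesis using assms selection_zero_sum[of n r I\<^sub>0 M] by (auto simp: b_alt)
next
  case False
  have "Max (selected_sum r M ` {I. selection n r c I}) \<in> selected_sum r M ` {I. selection n r c I}"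
    using assms finite_selected_sums by (intro Max_in) auto
  then show ?thesis using False by (auto simp: b_alt)
qed

text \<open>
  A row of \<open>M\<close> preceded by a zero entry. The zero stands for the choice of not selecting that
  row for any column; it is the base coordinate required by \<open>row_matching\<close>.
\<close>

definition ext_row :: "(entry \<Rightarrow> real) \<Rightarrow> nat \<Rightarrow> nat \<Rightarrow> real" where
  "ext_row M i \<alpha> = (if \<alpha> = 0 then 0 else M (i, \<alpha>))"

text \<open>
  Choosing one summand from the maximum of each row is an assignment \<open>\<psi>\<close> of columns to rows. Its
  value separates into a part that depends only on the numbers of rows assigned to the columns and
  the sum of the selected entries. Measuring \<open>t\<close> relative to \<open>t 0\<close> makes the rows that are assigned
  to \<open>0\<close> contribute nothing beyond \<open>n * t 0\<close>.
\<close>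

lemma assignment_value:
  assumes "\<psi> ` {1..n} \<subseteq> {..r}"
  shows "(\<Sum>i=1..n. t (\<psi> i) + ext_row M i (\<psi> i)) = real n * t 0
    + (\<Sum>\<alpha>=1..r. real (card {i\<in>{1..n}. \<psi> i = \<alpha>}) * (t \<alpha> - t 0))
    + selected_sum r M (\<lambda>\<alpha>. {i\<in>{1..n}. \<psi> i = \<alpha>})"
proof -
  define h where "h i = t (\<psi> i) - t 0 + ext_row M i (\<psi> i)" for i
  have "(\<Sum>i=1..n. t (\<psi> i) + ext_row M i (\<psi> i)) = (\<Sum>i=1..n. t 0 + h i)"
    by (simp add: h_def)
  also have "\<dots> = real n * t 0 + (\<Sum>i=1..n. h i)" by (simp add: sum.distrib)
  also have "(\<Sum>i=1..n. h i) = (\<Sum>\<alpha>\<in>{..r}. \<Sum>i\<in>{i\<in>{1..n}. \<psi> i = \<alpha>}. h i)"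
    using assms by (intro sum.group[symmetric]) auto
  also have "\<dots> = (\<Sum>\<alpha>\<in>{1..r}. \<Sum>i\<in>{i\<in>{1..n}. \<psi> i = \<alpha>}. h i)"
  proof (intro sum.mono_neutral_right ballI)
    fix \<alpha> assume "\<alpha> \<in> {..r} - {1..r}"
    then have "\<alpha> = 0" by auto
    then show "(\<Sum>i\<in>{i\<in>{1..n}. \<psi> i = \<alpha>}. h i) = 0"
      by (intro sum.neutral) (auto simp: h_def ext_row_def)
  qed auto
  also have "\<dots> = (\<Sum>\<alpha>=1..r. \<Sum>i\<in>{i\<in>{1..n}. \<psi> i = \<alpha>}. (t \<alpha> - t 0) + M (i, \<alpha>))"
    by (intro sum.cong refl) (auto simp: h_def ext_row_def)
  also have "\<dots> = (\<Sum>\<alpha>=1..r. real (card {i\<in>{1..n}. \<psi> i = \<alpha>}) * (t \<alpha> - t 0))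
      + selected_sum r M (\<lambda>\<alpha>. {i\<in>{1..n}. \<psi> i = \<alpha>})"
    by (simp add: sum.distrib selected_sum_def)
  finally show ?thesis by simp
qed

text \<open>
  The left-hand sum is a tropical product of \<open>n\<close> linear forms in \<open>t\<close>. Multiplied out, with \<open>t 0 = 0\<close>, it
  is the tropical polynomial \<open>max\<^sub>c (b\<^sub>c(M) + \<langle>c, t\<rangle>)\<close>, because assignments with \<open>c\<^sub>\<alpha>\<close> rows in
  column \<open>\<alpha>\<close> are exactly the selections in the definition of \<open>b\<^sub>c\<close>. Perturbing the
  coefficients by at most \<open>\<delta>\<close> changes the value by at most \<open>\<delta>\<close>.
\<close>

lemma tropical_product_le:
  assumes le: "\<And>c. c \<in> Idx n r \<Longrightarrow> b n r c M \<le> b n r c N + \<delta>" and "0 \<le> \<delta>"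
  shows "(\<Sum>i=1..n. Max ((\<lambda>\<alpha>. t \<alpha> + ext_row M i \<alpha>) ` {..r}))
    \<le> (\<Sum>i=1..n. Max ((\<lambda>\<alpha>. t \<alpha> + ext_row N i \<alpha>) ` {..r})) + \<delta>"
proof -
  have "Max ((\<lambda>\<alpha>. t \<alpha> + ext_row M i \<alpha>) ` {..r}) \<in> (\<lambda>\<alpha>. t \<alpha> + ext_row M i \<alpha>) ` {..r}" for i
    by (intro Max_in) auto
  then have "\<exists>\<alpha>\<in>{..r}. Max ((\<lambda>\<alpha>. t \<alpha> + ext_row M i \<alpha>) ` {..r}) = t \<alpha> + ext_row M i \<alpha>" for i
    by (meson imageE)
  then obtain \<phi> where \<phi>: "\<And>i. \<phi> i \<in> {..r}"
    "\<And>i. Max ((\<lambda>\<alpha>. t \<alpha> + ext_row M i \<alpha>) ` {..r}) = t (\<phi> i) + ext_row M i (\<phi> i)"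
    by metis
  define I where "I \<alpha> = {i\<in>{1..n}. \<phi> i = \<alpha>}" for \<alpha>
  define c where "c \<alpha> = (if \<alpha> \<in> {1..r} then card (I \<alpha>) else 0)" for \<alpha>
  have sel: "selection n r c I"
    by (auto simp: selection_def c_def I_def disjoint_family_on_def)
  have "(\<Sum>\<alpha>=1..r. c \<alpha>) = (\<Sum>\<alpha>=1..r. card (I \<alpha>))" by (simp add: c_def)
  also have "\<dots> = card (\<Union>\<alpha>\<in>{1..r}. I \<alpha>)"
    by (rule card_UN_disjoint[symmetric]) (auto simp: I_def)
  also have "\<dots> \<le> card {1..n}" by (intro card_mono) (auto simp: I_def)
  finally have total: "(\<Sum>\<alpha>=1..r. c \<alpha>) \<le> n" by simp
  have bc: "b n r c M \<le> b n r c N + \<delta>"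
  proof (cases "c = (\<lambda>_. 0)")
    case True
    then show ?thesis using \<open>0 \<le> \<delta>\<close> by (simp add: b_def)
  next
    case False
    then obtain \<alpha> where "c \<alpha> \<noteq> 0" by blast
    then have "0 < c \<alpha>" "\<alpha> \<in> {1..r}" by (auto simp: c_def split: if_splits)
    then have "0 < (\<Sum>\<alpha>=1..r. c \<alpha>)" by (metis finite_atLeastAtMost sum_pos2 zero_le)
    then show ?thesis using total by (intro le) (auto simp: Idx_def c_def)
  qed
  obtain J where J: "selection n r c J" "b n r c N = selected_sum r N J"
    using b_attained[OF sel] by blast
  \<comment> \<open>The assignment that belongs to \<open>J\<close>: rows in no \<open>J \<alpha>\<close> go to the column \<open>0\<close>.\<close>
  define \<psi> where "\<psi> i = (if \<exists>\<alpha>\<in>{1..r}. i \<in> J \<alpha> then SOME \<alpha>. \<alpha> \<in> {1..r} \<and> i \<in> J \<alpha> else 0)" for i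
  have \<psi>: "\<psi> i = \<alpha>" if "\<alpha> \<in> {1..r}" "i \<in> J \<alpha>" for i \<alpha>
  proof -
    have ex: "\<exists>\<alpha>. \<alpha> \<in> {1..r} \<and> i \<in> J \<alpha>" using that by blast
    then have *: "\<psi> i \<in> {1..r} \<and> i \<in> J (\<psi> i)"
      using someI_ex[OF ex] by (auto simp: \<psi>_def)
    then show ?thesis
      using J(1) that unfolding selection_def disjoint_family_on_def by blast
  qed
  have \<psi>_range: "\<psi> i \<in> {..r}" for i
  proof (cases "\<exists>\<alpha>\<in>{1..r}. i \<in> J \<alpha>")
    case True
    then show ?thesis using \<psi> by fastforce
  qed (simp add: \<psi>_def)
  have JI: "{i\<in>{1..n}. \<psi> i = \<alpha>} = J \<alpha>" if "\<alpha> \<in> {1..r}" for \<alpha>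
  proof -
    have "J \<alpha> \<subseteq> {1..n}" using J(1) that by (auto simp: selection_def)
    moreover have "i \<in> J \<alpha>" if "\<psi> i = \<alpha>" for i
    proof (cases "\<exists>\<beta>\<in>{1..r}. i \<in> J \<beta>")
      case True
      then show ?thesis using \<psi> that by blast
    next
      case False
      then have "\<psi> i = 0" by (simp add: \<psi>_def)
      then show ?thesis using that \<open>\<alpha> \<in> {1..r}\<close> by simp
    qed
    ultimately show ?thesis using \<psi>[OF that] by blast
  qed
  have "(\<Sum>i=1..n. Max ((\<lambda>\<alpha>. t \<alpha> + ext_row M i \<alpha>) ` {..r}))
      = real n * t 0 + (\<Sum>\<alpha>=1..r. real (c \<alpha>) * (t \<alpha> - t 0)) + selected_sum r M I"
    unfolding \<phi>(2) using \<phi>(1) by (subst assignment_value) (auto simp: I_def[abs_def] c_def)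
  also have "\<dots> \<le> real n * t 0 + (\<Sum>\<alpha>=1..r. real (c \<alpha>) * (t \<alpha> - t 0)) + selected_sum r N J + \<delta>"
    using selected_sum_le_b[OF sel, of M] bc J(2) by linarith
  also have "real n * t 0 + (\<Sum>\<alpha>=1..r. real (c \<alpha>) * (t \<alpha> - t 0)) + selected_sum r N J
      = (\<Sum>i=1..n. t (\<psi> i) + ext_row N i (\<psi> i))"
  proof -
    have "selected_sum r N (\<lambda>\<alpha>. {i\<in>{1..n}. \<psi> i = \<alpha>}) = selected_sum r N J"
      unfolding selected_sum_def by (intro sum.cong refl) (simp_all only: JI)
    moreover have "(\<Sum>\<alpha>=1..r. real (card {i\<in>{1..n}. \<psi> i = \<alpha>}) * (t \<alpha> - t 0))
        = (\<Sum>\<alpha>=1..r. real (c \<alpha>) * (t \<alpha> - t 0))"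
      using J(1) by (intro sum.cong refl) (simp_all only: JI selection_def)
    ultimately show ?thesis using \<psi>_range by (subst assignment_value) auto
  qed
  also have "\<dots> \<le> (\<Sum>i=1..n. Max ((\<lambda>\<alpha>. t \<alpha> + ext_row N i \<alpha>) ` {..r}))"
    using \<psi>_range by (intro sum_mono Max_ge) auto
  finally show ?thesis by simp
qed

section \<open>The number of indices\<close>

text \<open>
  Stars and bars: the index \<open>c\<close> is encoded by the list \<open>n - |c|, c\<^sub>1, \<dots>, c\<^sub>r\<close> of sum \<open>n\<close>. The zero
  index, which is not in \<open>Idx n r\<close>, accounts for the subtracted 1.
\<close>

lemma finite_Idx: "finite (Idx n r)"
  and card_Idx: "card (Idx n r) = (n + r choose r) - 1"
proof -
  define S where "S = {l::nat list. length l = Suc r \<and> sum_list l = n}"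
  define code where "code c = (n - (\<Sum>\<alpha>=1..r. c \<alpha>)) # map c [1..<Suc r]" for c :: index
  have sl: "sum_list (map c [1..<Suc r]) = (\<Sum>\<alpha>=1..r. c \<alpha>)" for c :: index
    by (simp add: sum_list_distinct_conv_sum_set atLeastLessThanSuc_atLeastAtMost del: upt_Suc)
  have zero: "(\<lambda>_. 0) \<notin> Idx n r" by (simp add: Idx_def)
  have ext: "c = d" if "\<And>\<alpha>. \<alpha> \<in> {1..r} \<Longrightarrow> c \<alpha> = d \<alpha>" "\<And>\<alpha>. \<alpha> \<notin> {1..r} \<Longrightarrow> c \<alpha> = d \<alpha>" for c d :: index
    using that by blast
  have bij: "bij_betw code (insert (\<lambda>_. 0) (Idx n r)) S"
    unfolding bij_betw_def
  proof (intro conjI equalityI subsetI)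
    show "inj_on code (insert (\<lambda>_. 0) (Idx n r))"
    proof (rule inj_onI)
      fix c d assume c: "c \<in> insert (\<lambda>_. 0) (Idx n r)" and d: "d \<in> insert (\<lambda>_. 0) (Idx n r)"
        and eq: "code c = code d"
      have "map c [1..<Suc r] = map d [1..<Suc r]" using eq by (simp add: code_def del: upt_Suc)
      then have "\<forall>\<alpha>\<in>{1..r}. c \<alpha> = d \<alpha>" by (simp add: atLeastLessThanSuc_atLeastAtMost del: upt_Suc)
      then show "c = d" using c d by (intro ext) (auto simp: Idx_def)
    qed
    fix l assume "l \<in> code ` insert (\<lambda>_. 0) (Idx n r)"
    then obtain c where c: "c \<in> insert (\<lambda>_. 0) (Idx n r)" "l = code c" by blast
    moreover have "(\<Sum>\<alpha>=1..r. c \<alpha>) \<le> n" using c(1) by (auto simp: Idx_def)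
    ultimately    show "l \<in> S" using sl[of c] by (simp add: S_def code_def del: upt_Suc)
  next
    fix l assume "l \<in> S"
    then obtain x xs where l: "l = x # xs" "length xs = r" "x + sum_list xs = n"
      by (cases l) (auto simp: S_def)
    define c where "c \<alpha> = (if \<alpha> \<in> {1..r} then xs ! (\<alpha> - 1) else 0)" for \<alpha>
    have xs: "map c [1..<Suc r] = xs"
      using l(2) by (intro nth_equalityI) (auto simp: c_def simp del: upt_Suc)
    then have "(\<Sum>\<alpha>=1..r. c \<alpha>) = sum_list xs" using sl[of c] by simp
    then have "l = code c" "(\<Sum>\<alpha>=1..r. c \<alpha>) \<le> n" using l xs by (auto simp: code_def)
    moreover have "c = (\<lambda>_. 0)" if "(\<Sum>\<alpha>=1..r. c \<alpha>) = 0" using that by (intro ext) (auto simp: c_def)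
    moreover have "c \<alpha> = 0" if "\<alpha> \<notin> {1..r}" for \<alpha> using that by (auto simp: c_def)
    ultimately have "l = code c" "c \<in> insert (\<lambda>_. 0) (Idx n r)"
      unfolding Idx_def neq0_conv[symmetric] by blast+
    then show "l \<in> code ` insert (\<lambda>_. 0) (Idx n r)" by blast
  qed
  have card: "card S = (n + r choose r)"
    unfolding S_def card_length_sum_list by (simp add: binomial_symmetric[of n "n + r"])
  have "0 < card S" by (simp add: card)
  then have "finite (insert (\<lambda>_. 0) (Idx n r))" using bij bij_betw_finite card.infinite by fastforce
  then show fin: "finite (Idx n r)" by simp
  show "card (Idx n r) = (n + r choose r) - 1"
    using bij_betw_same_card[OF bij] card zero fin by simp
qed

section \<open>Existence of a lower Lipschitz constant\<close>

lemma orbit_dist_le: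
  assumes "\<pi> permutes {1..n}"
  shows "orbit_dist n r M N \<le> L2_set (\<lambda>p. M p - row_act \<pi> N p) ({1..n} \<times> {1..r})"
  unfolding orbit_dist_def using assms finite_permutations[of "{1..n}"]
  by (intro Min_le) (auto simp: setcompr_eq_image)

lemma orbit_dist_attained:
  "\<exists>\<pi>. \<pi> permutes {1..n} \<and> orbit_dist n r M N = L2_set (\<lambda>p. M p - row_act \<pi> N p) ({1..n} \<times> {1..r})"
proof -
  have "orbit_dist n r M N \<in> {L2_set (\<lambda>p. M p - row_act \<pi> N p) ({1..n} \<times> {1..r}) | \<pi>. \<pi> permutes {1..n}}"
    unfolding orbit_dist_def using finite_permutations[of "{1..n}"]
    by (intro Min_in) (auto simp: setcompr_eq_image intro: permutes_id)
  then show ?thesis by blast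
qed

text \<open>
  This makes the doubling search terminate when no explicit constant is supplied. The differences
  of the coordinates of \<open>\<Phi>\<close> control the tropical products of the rows, hence by
  \<open>row_matching\<close> a matching of the rows, hence the distance of the orbits.
\<close>

lemma lower_Lipschitz_const_exists:
  assumes "0 < n" "0 < r"
  shows "\<exists>C. lower_Lipschitz_const n r C"
proof -
  define B :: real where "B = real (n * r) * (1 + 2 ^ Suc r) ^ n"
  have "0 < B" using assms by (simp add: B_def add_pos_pos)
  have "orbit_dist n r M N \<le> B * L2_set (\<lambda>c. Phi n r M c - Phi n r N c) (Idx n r)" for M N
  proof -
    define \<delta> where "\<delta> = L2_set (\<lambda>c. Phi n r M c - Phi n r N c) (Idx n r)"
    have "\<bar>b n r c M - b n r c N\<bar> \<le> \<delta>" if "c \<in> Idx n r" for c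
    proof -
      have "\<bar>Phi n r M c - Phi n r N c\<bar> \<le> L2_set (\<lambda>c. \<bar>Phi n r M c - Phi n r N c\<bar>) (Idx n r)"
        using that finite_Idx by (intro member_le_L2_set)
      then show ?thesis using that by (simp add: \<delta>_def Phi_def L2_set_def)
    qed
    then have le: "b n r c M \<le> b n r c N + \<delta>" "b n r c N \<le> b n r c M + \<delta>" if "c \<in> Idx n r" for c
      using that by (force simp: abs_le_iff)+
    have "0 \<le> \<delta>" by (simp add: \<delta>_def)
    have "\<bar>(\<Sum>i=1..n. Max ((\<lambda>\<alpha>. t \<alpha> + ext_row M i \<alpha>) ` {..r}))
        - (\<Sum>i=1..n. Max ((\<lambda>\<alpha>. t \<alpha> + ext_row N i \<alpha>) ` {..r}))\<bar> \<le> \<delta>" for t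
      using tropical_product_le[OF le(1) \<open>0 \<le> \<delta>\<close>, of t] tropical_product_le[OF le(2) \<open>0 \<le> \<delta>\<close>, of t]
      by (simp add: abs_le_iff)
    then have "\<exists>\<pi>. bij_betw \<pi> {1..n} {1..n} \<and> (\<forall>i\<in>{1..n}. \<forall>\<alpha>\<in>{..r}.
        \<bar>ext_row M i \<alpha> - ext_row N (\<pi> i) \<alpha>\<bar> \<le> (1 + 2 ^ card {..r}) ^ card {1..n} * \<delta>)"
      by (intro row_matching[where z = 0]) (simp_all add: ext_row_def)
    then obtain \<pi> where \<pi>: "bij_betw \<pi> {1..n} {1..n}"
      "\<And>i \<alpha>. i \<in> {1..n} \<Longrightarrow> \<alpha> \<in> {..r} \<Longrightarrow>
         \<bar>ext_row M i \<alpha> - ext_row N (\<pi> i) \<alpha>\<bar> \<le> (1 + 2 ^ card {..r}) ^ card {1..n} * \<delta>"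
      by blast
    define p where "p i = (if i \<in> {1..n} then \<pi> i else i)" for i
    have "bij_betw p {1..n} {1..n}"
      using \<pi>(1) by (subst bij_betw_cong[of _ _ \<pi>]) (simp_all add: p_def)
    then have p: "p permutes {1..n}"
      by (rule bij_imp_permutes) (auto simp: p_def)
    have "orbit_dist n r M N \<le> L2_set (\<lambda>q. M q - row_act (inv p) N q) ({1..n} \<times> {1..r})"
      by (intro orbit_dist_le permutes_inv p)
    also have "\<dots> \<le> (\<Sum>q\<in>{1..n} \<times> {1..r}. \<bar>M q - row_act (inv p) N q\<bar>)"
      by (rule L2_set_le_sum_abs)
    also have "\<dots> \<le> (\<Sum>q\<in>{1..n} \<times> {1..r}. (1 + 2 ^ Suc r) ^ n * \<delta>)"
    proof (intro sum_mono)
      fix q assume "q \<in> {1..n} \<times> {1..r}"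
      then obtain i \<alpha> where q: "q = (i, \<alpha>)" "i \<in> {1..n}" "\<alpha> \<in> {1..r}" by auto
      show "\<bar>M q - row_act (inv p) N q\<bar> \<le> (1 + 2 ^ Suc r) ^ n * \<delta>"
        using \<pi>(2)[of i \<alpha>] q by (simp add: row_act_def permutes_inv_inv[OF p] p_def ext_row_def)
    qed
    also have "\<dots> = B * \<delta>" by (simp add: B_def)
    finally show ?thesis by (simp add: \<delta>_def)
  qed
  then have "lower_Lipschitz_const n r (1 / B)"
    using \<open>0 < B\<close> by (simp add: lower_Lipschitz_const_def field_simps)
  then show ?thesis by blast
qed

abbreviation pure_index :: "nat \<Rightarrow> nat \<Rightarrow> index" where
  "pure_index k \<alpha> \<equiv> (\<lambda>\<beta>. if \<beta> = \<alpha> then k else 0)"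

section \<open>Sorted columns and row permutations\<close>

text \<open>
  Exchange argument: \<open>J - {1..k}\<close> and \<open>{1..k} - J\<close> have equally many elements, and \<open>y k\<close> separates
  the values of \<open>y\<close> on them.
\<close>

lemma sum_le_initial_sum:
  fixes y :: "nat \<Rightarrow> real"
  assumes anti: "\<And>i j. 1 \<le> i \<Longrightarrow> i \<le> j \<Longrightarrow> j \<le> n \<Longrightarrow> y j \<le> y i"
    and J: "J \<subseteq> {1..n}" "card J = k"
  shows "sum y J \<le> sum y {1..k}"
proof (cases "k = 0")
  case True
  moreover have "finite J" using J(1) finite_subset by blast
  ultimately show ?thesis using J by simp
next
  case False
  define K where "K = {1..k}"
  have fin: "finite J" "finite K" using J(1) finite_subset by (auto simp: K_def)
  have "k \<le> n" using J card_mono[of "{1..n}" J] by simp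
  have "card (J - K) = card (K - J)"
    using card_Int_Diff[OF fin(1), of K] card_Int_Diff[OF fin(2), of J] J(2)
    by (simp add: K_def Int_commute)
  have "sum y (J - K) \<le> of_nat (card (J - K)) * y k"
    using J(1) False by (intro sum_bounded_above anti) (auto simp: K_def)
  also have "\<dots> = of_nat (card (K - J)) * y k" by (simp add: \<open>card (J - K) = card (K - J)\<close>)
  also have "\<dots> \<le> sum y (K - J)"
    using \<open>k \<le> n\<close> by (intro sum_bounded_below anti) (auto simp: K_def)
  finally have "sum y (J - K) + sum y (J \<inter> K) \<le> sum y (K - J) + sum y (K \<inter> J)"
    by (simp add: Int_commute)
  then show ?thesis
    using sum.Int_Diff[OF fin(1), of y K] sum.Int_Diff[OF fin(2), of y J] by (simp add: K_def)
qed

lemma sorting_permutation: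
  fixes x :: "nat \<Rightarrow> real"
  shows "\<exists>s. s permutes {1..n} \<and> (\<forall>i j. 1 \<le> i \<longrightarrow> i \<le> j \<longrightarrow> j \<le> n \<longrightarrow> x (s j) \<le> x (s i))"
proof -
  define l where "l = sort_key (\<lambda>i. - x i) [1..<Suc n]"
  have l: "length l = n" "distinct l" "set l = {1..n}" "sorted (map (\<lambda>i. - x i) l)"
    by (auto simp: l_def simp del: upt_Suc)
  define s where "s i = (if i \<in> {1..n} then l ! (i - 1) else i)" for i
  have "inj_on s {1..n}"
    using l(1,2) by (intro inj_onI) (auto simp: s_def nth_eq_iff_index_eq)
  moreover have sub: "s ` {1..n} \<subseteq> {1..n}"
  proof
    fix k assume "k \<in> s ` {1..n}"
    then obtain i where "i \<in> {1..n}" "k = l ! (i - 1)" by (auto simp: s_def)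
    then have "k \<in> set l" using l(1) by auto
    then show "k \<in> {1..n}" using l(3) by simp
  qed
  ultimately have "bij_betw s {1..n} {1..n}"
    using endo_inj_surj[OF _ sub] by (simp add: bij_betw_def)
  then have "s permutes {1..n}" by (rule bij_imp_permutes) (auto simp: s_def)
  moreover have "x (s j) \<le> x (s i)" if "1 \<le> i" "i \<le> j" "j \<le> n" for i j
    using sorted_nth_mono[OF l(4), of "i - 1" "j - 1"] that l(1) by (simp add: s_def)
  ultimately show ?thesis by blast
qed

lemma pure_selected_sum:
  assumes "selection n r (pure_index k \<alpha>) I" "\<alpha> \<in> {1..r}"
  shows "selected_sum r M I = (\<Sum>i\<in>I \<alpha>. M (i, \<alpha>))"
proof -
  have "I \<beta> = {}" if "\<beta> \<in> {1..r} - {\<alpha>}" for \<beta>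
  proof -
    have "card (I \<beta>) = 0" "I \<beta> \<subseteq> {1..n}"
      using assms(1) that unfolding selection_def by auto
    moreover from this have "finite (I \<beta>)" using finite_subset by blast
    ultimately show ?thesis by simp
  qed
  then have "selected_sum r M I = (\<Sum>\<beta>\<in>{\<alpha>}. \<Sum>i\<in>I \<beta>. M (i, \<beta>))"
    unfolding selected_sum_def using assms(2) by (intro sum.mono_neutral_right) auto
  then show ?thesis by simp
qed

text \<open>
  For \<open>c = k e\<^sub>\<alpha>\<close> the selection consists of one set of \<open>k\<close> rows, and the best choice is the \<open>k\<close> largest
  entries of column \<open>\<alpha>\<close>. Thus the pure coordinates of \<open>\<Phi>\<close> record each column up to order.
\<close>

lemma b_pure:
  assumes \<alpha>: "\<alpha> \<in> {1..r}" and "k \<le> n" and s: "s permutes {1..n}"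
    and anti: "\<And>i j. 1 \<le> i \<Longrightarrow> i \<le> j \<Longrightarrow> j \<le> n \<Longrightarrow> M (s j, \<alpha>) \<le> M (s i, \<alpha>)"
  shows "b n r (pure_index k \<alpha>) M = (\<Sum>j=1..k. M (s j, \<alpha>))"
proof (rule antisym)
  have inj: "inj_on s A" for A by (rule permutes_inj_on[OF s])
  define I\<^sub>0 where "I\<^sub>0 \<beta> = (if \<beta> = \<alpha> then s ` {1..k} else {})" for \<beta>
  have "s ` {1..k} \<subseteq> {1..n}"
    using image_mono[of "{1..k}" "{1..n}" s] permutes_image[OF s] \<open>k \<le> n\<close> by simp
  moreover have "card (s ` {1..k}) = k" by (simp add: card_image inj)
  ultimately have I0: "selection n r (pure_index k \<alpha>) I\<^sub>0"
    by (auto simp: selection_def I\<^sub>0_def disjoint_family_on_def)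
  have "(\<Sum>j=1..k. M (s j, \<alpha>)) = selected_sum r M I\<^sub>0"
    unfolding pure_selected_sum[OF I0 \<alpha>] by (simp add: I\<^sub>0_def sum.reindex[OF inj])
  then show "(\<Sum>j=1..k. M (s j, \<alpha>)) \<le> b n r (pure_index k \<alpha>) M"
    using selected_sum_le_b[OF I0] by simp
  obtain I where I: "selection n r (pure_index k \<alpha>) I"
    "b n r (pure_index k \<alpha>) M = selected_sum r M I"
    using b_attained[OF I0] by blast
  have I\<alpha>: "I \<alpha> \<subseteq> {1..n}" "card (I \<alpha>) = k" using I(1) \<alpha> by (auto simp: selection_def)
  define J where "J = inv s ` I \<alpha>"
  have sJ: "s ` J = I \<alpha>" by (simp add: J_def image_comp permutes_inverses(1)[OF s] comp_def)
  have "J \<subseteq> {1..n}"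
    using image_mono[OF I\<alpha>(1), of "inv s"] permutes_image[OF permutes_inv[OF s]] by (simp add: J_def)
  moreover have "card J = k" using I\<alpha>(2) card_image[OF inj, of J] by (simp add: sJ)
  ultimately have "(\<Sum>j\<in>J. M (s j, \<alpha>)) \<le> (\<Sum>j=1..k. M (s j, \<alpha>))"
    using anti by (intro sum_le_initial_sum[of n]) auto
  moreover have "selected_sum r M I = (\<Sum>j\<in>J. M (s j, \<alpha>))"
    unfolding pure_selected_sum[OF I(1) \<alpha>] sJ[symmetric] by (simp add: sum.reindex[OF inj])
  ultimately show "b n r (pure_index k \<alpha>) M \<le> (\<Sum>j=1..k. M (s j, \<alpha>))" using I(2) by simp
qed

lemma b_pure_permute_column:
  assumes "\<alpha> \<in> {1..r}" "k \<le> n" and p: "p permutes {1..n}"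
    and N: "\<And>i. i \<in> {1..n} \<Longrightarrow> N (i, \<alpha>) = M (p i, \<alpha>)"
  shows "b n r (pure_index k \<alpha>) N = b n r (pure_index k \<alpha>) M"
proof -
  obtain s where s: "s permutes {1..n}"
    and anti: "\<And>i j. 1 \<le> i \<Longrightarrow> i \<le> j \<Longrightarrow> j \<le> n \<Longrightarrow> M (s j, \<alpha>) \<le> M (s i, \<alpha>)"
    using sorting_permutation[of n "\<lambda>i. M (i, \<alpha>)"] by blast
  define s' where "s' = inv p \<circ> s"
  have s': "s' permutes {1..n}" unfolding s'_def by (intro permutes_compose s permutes_inv p)
  have val: "N (s' j, \<alpha>) = M (s j, \<alpha>)" if "j \<in> {1..n}" for j
    using N[of "s' j"] permutes_in_image[OF s', of j] that permutes_inverses(1)[OF p]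
    by (simp add: s'_def)
  have "b n r (pure_index k \<alpha>) N = (\<Sum>j=1..k. N (s' j, \<alpha>))"
    using assms(1,2) s' by (rule b_pure) (use anti val in auto)
  also have "\<dots> = (\<Sum>j=1..k. M (s j, \<alpha>))"
    using val \<open>k \<le> n\<close> by (intro sum.cong) auto
  also have "\<dots> = b n r (pure_index k \<alpha>) M"
    using b_pure[of \<alpha> r k n s M] assms(1,2) s anti by simp
  finally show ?thesis .
qed

text \<open>
  A permutation of the rows carries selections to selections.
\<close>

lemma b_permute_rows:
  assumes p: "p permutes {1..n}"
    and N: "\<And>i \<alpha>. i \<in> {1..n} \<Longrightarrow> \<alpha> \<in> {1..r} \<Longrightarrow> N (i, \<alpha>) = M (p i, \<alpha>)"
  shows "b n r c N = b n r c M"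
proof -
  have sub: "selected_sum r N ` {I. selection n r c I} \<subseteq> selected_sum r M ` {I. selection n r c I}"
    if p: "p permutes {1..n}"
      and N: "\<And>i \<alpha>. i \<in> {1..n} \<Longrightarrow> \<alpha> \<in> {1..r} \<Longrightarrow> N (i, \<alpha>) = M (p i, \<alpha>)" for p and M N :: "entry \<Rightarrow> real"
  proof
    fix x assume "x \<in> selected_sum r N ` {I. selection n r c I}"
    then obtain I where I: "selection n r c I" "x = selected_sum r N I" by blast
    have inj: "inj_on p A" for A by (rule permutes_inj_on[OF p])
    define J where "J \<alpha> = p ` I \<alpha>" for \<alpha>
    have sub: "I \<alpha> \<subseteq> {1..n}" "card (I \<alpha>) = c \<alpha>" if "\<alpha> \<in> {1..r}" for \<alpha>
      using I(1) that by (simp_all only: selection_def)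
    have "J \<alpha> \<subseteq> {1..n}" if "\<alpha> \<in> {1..r}" for \<alpha>
      using image_mono[OF sub(1)[OF that], of p] permutes_image[OF p] by (simp only: J_def)
    moreover have "card (J \<alpha>) = c \<alpha>" if "\<alpha> \<in> {1..r}" for \<alpha>
      using sub(2)[OF that] by (simp add: J_def card_image inj)
    moreover have "disjoint_family_on J {1..r}"
      using I(1) permutes_inj[OF p]
      by (auto simp: selection_def disjoint_family_on_def J_def simp flip: image_Int)
    ultimately have "selection n r c J" unfolding selection_def by blast
    moreover have "selected_sum r M J = x"
      unfolding I(2) selected_sum_def J_def sum.reindex[OF inj]
      using sub(1) N by (intro sum.cong refl) (simp add: subset_eq)
    ultimately show "x \<in> selected_sum r M ` {I. selection n r c I}" by blast
  qed
  have inv: "M (i, \<alpha>) = N (inv p i, \<alpha>)" if "i \<in> {1..n}" "\<alpha> \<in> {1..r}" for i \<alpha>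
    using N[of "inv p i" \<alpha>] that permutes_in_image[OF permutes_inv[OF p], of i]
    by (simp add: permutes_inverses(1)[OF p])
  have "selected_sum r N ` {I. selection n r c I} = selected_sum r M ` {I. selection n r c I}"
  proof (rule equalityI)
    show "selected_sum r N ` {I. selection n r c I} \<subseteq> selected_sum r M ` {I. selection n r c I}"
      using p N by (rule sub)
    show "selected_sum r M ` {I. selection n r c I} \<subseteq> selected_sum r N ` {I. selection n r c I}"
      using permutes_inv[OF p] inv by (rule sub)
  qed
  then show ?thesis by (simp add: b_alt)
qed

section \<open>Reconstructed columns\<close>

lemma pure_index_in_Idx:
  assumes "\<alpha> \<in> {1..r}" "1 \<le> k" "k \<le> n"
  shows "pure_index k \<alpha> \<in> Idx n r"
  using assms by (auto simp: Idx_def sum.delta)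

lemma teval_pure_coord:
  assumes "\<alpha> \<in> {1..r}" "k \<le> n"
  shows "teval (pure_coord k \<alpha>) (Phi n r M) = b n r (pure_index k \<alpha>) M"
  using pure_index_in_Idx[OF assms(1) _ assms(2)] by (auto simp: pure_coord_def Phi_def b_def)

text \<open>
  Consecutive pure coordinates differ by one entry of the sorted column: the \<open>k\<close>-th largest one.
\<close>

lemma teval_M_hat:
  assumes \<alpha>: "\<alpha> \<in> {1..r}" and k: "\<sigma> ! (\<alpha> - 1) ! (i - 1) \<in> {1..n}" and s: "s permutes {1..n}"
    and anti: "\<And>i j. 1 \<le> i \<Longrightarrow> i \<le> j \<Longrightarrow> j \<le> n \<Longrightarrow> M (s j, \<alpha>) \<le> M (s i, \<alpha>)"
  shows "teval (M_hat \<sigma> (i, \<alpha>)) (Phi n r M) = M (s (\<sigma> ! (\<alpha> - 1) ! (i - 1)), \<alpha>)"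
proof -
  define k where "k = \<sigma> ! (\<alpha> - 1) ! (i - 1)"
  obtain k' where k': "k = Suc k'" "Suc k' \<le> n" using assms(2) unfolding k_def[symmetric] by (cases k) auto
  have top: "teval (pure_coord j \<alpha>) (Phi n r M) = (\<Sum>i=1..j. M (s i, \<alpha>))" if "j \<le> n" for j
    unfolding teval_pure_coord[OF \<alpha> that] using b_pure[of \<alpha> r j n s M] \<alpha> that s anti by simp
  have "M_hat \<sigma> (i, \<alpha>) = TSub (pure_coord k \<alpha>) (pure_coord (k - 1) \<alpha>)"
    by (simp only: M_hat_def k_def Let_def prod.case)
  then show ?thesis
    using top[of k] top[of k'] k' unfolding k_def[symmetric] by simp
qed

lemma perm_tuples_bij:
  assumes "\<sigma> \<in> set (perm_tuples n r)" "\<alpha> \<in> {1..r}"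
  shows "bij_betw (\<lambda>i. \<sigma> ! (\<alpha> - 1) ! (i - 1)) {1..n} {1..n}"
proof -
  obtain \<tau> where \<tau>: "\<sigma> = [1..<Suc n] # \<tau>" "length \<tau> = r - 1" "set \<tau> \<subseteq> set (perm_lists n)"
    using assms(1) by (auto simp: perm_tuples_def set_n_lists simp del: upt_Suc)
  have "[1..<Suc n] \<in> set (perm_lists n)"
    by (simp add: perm_lists_def set_n_lists del: upt_Suc)
  moreover have "\<sigma> ! (\<alpha> - 1) \<in> set \<sigma>" using assms(2) \<tau>(1,2) by (intro nth_mem) auto
  ultimately have "\<sigma> ! (\<alpha> - 1) \<in> set (perm_lists n)" using \<tau>(1,3) by auto
  then obtain l where l: "\<sigma> ! (\<alpha> - 1) = l" "length l = n" "distinct l" "set l \<subseteq> {1..n}"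
    by (auto simp: perm_lists_def set_n_lists atLeastLessThanSuc_atLeastAtMost simp del: upt_Suc)
  have inj: "inj_on (\<lambda>i. l ! (i - 1)) {1..n}"
    using l(2,3) by (intro inj_onI) (auto simp: nth_eq_iff_index_eq)
  have sub: "(\<lambda>i. l ! (i - 1)) ` {1..n} \<subseteq> {1..n}"
  proof
    fix k assume "k \<in> (\<lambda>i. l ! (i - 1)) ` {1..n}"
    then obtain i where "i \<in> {1..n}" "k = l ! (i - 1)" by blast
    then have "k \<in> set l" using l(2) by auto
    then show "k \<in> {1..n}" using l(4) by blast
  qed
  show ?thesis unfolding l(1) bij_betw_def using inj endo_inj_surj[OF _ sub inj] by simp
qed

text \<open>
  The first permutation of a tuple is the identity, so this is the form in which the sorting
  permutations of the columns, normalised by that of column 1, enter the minimum.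
\<close>

lemma perm_tuple_exists:
  assumes "0 < r" and q: "\<And>\<alpha>. q \<alpha> permutes {1..n}" and "q 1 = id"
  shows "\<exists>\<sigma>\<in>set (perm_tuples n r). \<forall>\<alpha>\<in>{1..r}. \<forall>i\<in>{1..n}. \<sigma> ! (\<alpha> - 1) ! (i - 1) = q \<alpha> i"
proof (intro bexI ballI)
  define \<sigma> where "\<sigma> = map (\<lambda>\<alpha>. map (q \<alpha>) [1..<Suc n]) [1..<Suc r]"
  show "\<sigma> ! (\<alpha> - 1) ! (i - 1) = q \<alpha> i" if "\<alpha> \<in> {1..r}" "i \<in> {1..n}" for \<alpha> i
    using that by (auto simp: \<sigma>_def simp del: upt_Suc)
  have mem: "map (q \<alpha>) [1..<Suc n] \<in> set (perm_lists n)" for \<alpha>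
    using permutes_inj_on[OF q] permutes_image[OF q, of \<alpha>]
    by (auto simp: perm_lists_def set_n_lists distinct_map atLeastLessThanSuc_atLeastAtMost simp del: upt_Suc)
  have "[1..<Suc r] = 1 # [2..<Suc r]"
    using \<open>0 < r\<close> by (simp add: upt_conv_Cons numeral_2_eq_2 del: upt_Suc)
  then have "\<sigma> = [1..<Suc n] # map (\<lambda>\<alpha>. map (q \<alpha>) [1..<Suc n]) [2..<Suc r]"
    using \<open>q 1 = id\<close> by (simp add: \<sigma>_def del: upt_Suc)
  moreover have "map (\<lambda>\<alpha>. map (q \<alpha>) [1..<Suc n]) [2..<Suc r] \<in> set (List.n_lists (r - 1) (perm_lists n))"
    using mem unfolding set_n_lists by (auto simp del: upt_Suc One_nat_def)
  ultimately show "\<sigma> \<in> set (perm_tuples n r)"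
    unfolding perm_tuples_def by simp
qed

section \<open>Pure and mixed indices\<close>

lemma mixed_indices_iff:
  "c \<in> set (mixed_indices n r) \<longleftrightarrow> c \<in> Idx n r \<and> 2 \<le> card {\<alpha>\<in>{1..r}. c \<alpha> \<noteq> 0}"
proof (intro iffI conjI)
  assume c: "c \<in> set (mixed_indices n r)"
  then show two: "2 \<le> card {\<alpha>\<in>{1..r}. c \<alpha> \<noteq> 0}" by (simp add: mixed_indices_def)
  have "0 < (\<Sum>\<alpha>=1..r. c \<alpha>)"
  proof (rule ccontr)
    assume "\<not> 0 < (\<Sum>\<alpha>=1..r. c \<alpha>)"
    then have "{\<alpha>\<in>{1..r}. c \<alpha> \<noteq> 0} = {}" by auto
    then show False using two by (metis card.empty not_numeral_le_zero)
  qed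
  moreover have "(\<Sum>\<alpha>=1..r. c \<alpha>) \<le> n" "\<alpha> \<notin> {1..r} \<Longrightarrow> c \<alpha> = 0" for \<alpha>
    using c by (auto simp: mixed_indices_def index_of_list_def simp del: upt_Suc)
  ultimately show "c \<in> Idx n r" unfolding Idx_def by blast
next
  assume c: "c \<in> Idx n r \<and> 2 \<le> card {\<alpha>\<in>{1..r}. c \<alpha> \<noteq> 0}"
  have "c \<alpha> \<le> n" if "\<alpha> \<in> {1..r}" for \<alpha>
  proof -
    have "c \<alpha> \<le> (\<Sum>\<alpha>=1..r. c \<alpha>)" using that by (intro member_le_sum) auto
    then show ?thesis using c by (simp add: Idx_def)
  qed
  then have "map c [1..<Suc r] \<in> set (List.n_lists r [0..<Suc n])"
    by (auto simp: set_n_lists less_Suc_eq_le simp del: upt_Suc)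
  moreover have "c = index_of_list r (map c [1..<Suc r])"
    using c by (auto simp: index_of_list_def Idx_def fun_eq_iff simp del: upt_Suc)
  ultimately show "c \<in> set (mixed_indices n r)"
    using c unfolding mixed_indices_def Idx_def by auto
qed

lemma Idx_cases:
  assumes "c \<in> Idx n r"
  obtains "c \<in> set (mixed_indices n r)"
  | \<alpha> k where "\<alpha> \<in> {1..r}" "k \<le> n" "c = pure_index k \<alpha>"
proof (cases "2 \<le> card {\<alpha>\<in>{1..r}. c \<alpha> \<noteq> 0}")
  case True
  then show ?thesis using assms that(1) by (simp add: mixed_indices_iff)
next
  case False
  have "\<not> (\<forall>\<alpha>\<in>{1..r}. c \<alpha> = 0)" using assms by (metis (no_types, lifting) Idx_def less_irrefl mem_Collect_eq sum.neutral)
  then obtain \<alpha> where \<alpha>: "\<alpha> \<in> {1..r}" "c \<alpha> \<noteq> 0" by blast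
  have "c \<beta> = 0" if "\<beta> \<noteq> \<alpha>" for \<beta>
  proof (cases "\<beta> \<in> {1..r}")
    case True
    show ?thesis
    proof (rule ccontr)
      assume "c \<beta> \<noteq> 0"
      then have "card {\<alpha>, \<beta>} \<le> card {\<alpha>\<in>{1..r}. c \<alpha> \<noteq> 0}"
        using \<alpha> True by (intro card_mono) auto
      then show False using False that by simp
    qed
  next
    case False
    then show ?thesis using assms by (simp add: Idx_def)
  qed
  then have "c = pure_index (c \<alpha>) \<alpha>" by auto
  moreover have "c \<alpha> \<le> (\<Sum>\<alpha>=1..r. c \<alpha>)" using \<alpha> by (intro member_le_sum) auto
  then have "c \<alpha> \<le> n" using assms by (simp add: Idx_def)
  ultimately show ?thesis using that(2) \<alpha>(1) by blast
qed

section \<open>Lipschitz bounds for the input\<close>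

lemma set_entries: "set (entries n r) = {1..n} \<times> {1..r}"
  by (auto simp: entries_def simp del: upt_Suc)

lemma teval_poly_expr:
  assumes "ts \<noteq> []"
  shows "teval (poly_expr n r ts) M =
    Max ((\<lambda>(\<gamma>, a). \<gamma> + (\<Sum>v\<in>{1..n} \<times> {1..r}. real (a v) * M v)) ` set ts)"
proof -
  have "teval (tsum_list [TMul (int (a v)) (TVar v). v \<leftarrow> entries n r]) M
      = (\<Sum>v\<in>{1..n} \<times> {1..r}. real (a v) * M v)" for a
  proof -
    have "distinct (entries n r)" by (simp add: entries_def distinct_product)
    then show ?thesis
      by (simp add: teval_tsum_list comp_def sum_list_distinct_conv_sum_set set_entries)
  qed
  then show ?thesis
    unfolding poly_expr_def using assms
    by (subst teval_tmax_list) (simp_all add: image_image case_prod_beta)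
qed

text \<open>
  An affine function with nonnegative coefficients changes by at most the sum of its coefficients
  times the largest change of an argument, and maxima preserve such bounds.
\<close>

lemma poly_expr_Lipschitz:
  assumes "ts \<noteq> []" and d: "\<And>v. v \<in> {1..n} \<times> {1..r} \<Longrightarrow> \<bar>M v - N v\<bar> \<le> d" "0 \<le> d"
  shows "\<bar>teval (poly_expr n r ts) M - teval (poly_expr n r ts) N\<bar> \<le> real (max_norm1 n r ts) * d"
  unfolding teval_poly_expr[OF assms(1)]
proof (rule Max_image_diff_le)
  fix p assume p: "p \<in> set ts"
  obtain \<gamma> a where [simp]: "p = (\<gamma>, a)" by (cases p)
  have "\<bar>\<Sum>v\<in>{1..n} \<times> {1..r}. real (a v) * (M v - N v)\<bar> \<le> (\<Sum>v\<in>{1..n} \<times> {1..r}. real (a v) * d)"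
    using d(1) by (intro order_trans[OF sum_abs] sum_mono) (simp add: abs_mult mult_left_mono)
  also have "\<dots> = real (\<Sum>v\<in>{1..n} \<times> {1..r}. a v) * d" by (simp add: sum_distrib_right)
  also have "\<dots> \<le> real (max_norm1 n r ts) * d"
  proof -
    have "(\<Sum>v\<in>{1..n} \<times> {1..r}. a v) \<le> max_norm1 n r ts"
      unfolding max_norm1_def using p by (intro Max_ge) force+
    then have "real (\<Sum>v\<in>{1..n} \<times> {1..r}. a v) \<le> real (max_norm1 n r ts)" by (rule of_nat_mono)
    then show ?thesis using d(2) by (rule mult_right_mono)
  qed
  finally show "\<bar>(case p of (\<gamma>, a) \<Rightarrow> \<gamma> + (\<Sum>v\<in>{1..n} \<times> {1..r}. real (a v) * M v))
      - (case p of (\<gamma>, a) \<Rightarrow> \<gamma> + (\<Sum>v\<in>{1..n} \<times> {1..r}. real (a v) * N v))\<bar>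
      \<le> real (max_norm1 n r ts) * d"
    by (simp add: right_diff_distrib sum_subtractf)
qed (use assms in auto)

lemma input_expr_Lipschitz:
  assumes "P \<noteq> []" "Q \<noteq> []"
    and "\<And>v. v \<in> {1..n} \<times> {1..r} \<Longrightarrow> \<bar>M v - N v\<bar> \<le> d" "0 \<le> d"
  shows "\<bar>teval (input_expr n r P Q) M - teval (input_expr n r P Q) N\<bar> \<le> real (Lip_bound n r P Q) * d"
proof -
  have "\<bar>teval (poly_expr n r P) M - teval (poly_expr n r P) N\<bar> \<le> real (max_norm1 n r P) * d"
    and "\<bar>teval (poly_expr n r Q) M - teval (poly_expr n r Q) N\<bar> \<le> real (max_norm1 n r Q) * d"
    using assms by (intro poly_expr_Lipschitz; simp)+
  then show ?thesis by (simp add: input_expr_def Lip_bound_def algebra_simps)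
qed

text \<open>
  By invariance, \<open>N\<close> may be replaced by the point of its orbit that is closest to \<open>M\<close>. The lower Lipschitz
  constant bounds this distance by the Euclidean distance of the images under \<open>\<Phi>\<close>, which is at
  most \<open>\<surd>K\<close> times the largest difference of a coordinate.
\<close>

lemma invariant_Lipschitz:
  assumes "P \<noteq> []" "Q \<noteq> []" and inv: "row_invariant n (input_expr n r P Q)"
    and C: "lower_Lipschitz_const n r C"
    and \<delta>: "\<And>c. c \<in> Idx n r \<Longrightarrow> \<bar>b n r c M - b n r c N\<bar> \<le> \<delta>" "0 \<le> \<delta>"
  shows "\<bar>teval (input_expr n r P Q) M - teval (input_expr n r P Q) N\<bar>
    \<le> real (Lip_bound n r P Q) * sqrt (real ((n + r choose r) - 1)) / C * \<delta>"
proof -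
  have "0 < C" using C by (simp add: lower_Lipschitz_const_def)
  obtain \<pi> where \<pi>: "\<pi> permutes {1..n}"
    "orbit_dist n r M N = L2_set (\<lambda>p. M p - row_act \<pi> N p) ({1..n} \<times> {1..r})"
    using orbit_dist_attained by blast
  define d where "d = orbit_dist n r M N"
  have "C * d \<le> L2_set (\<lambda>c. Phi n r M c - Phi n r N c) (Idx n r)"
    using C by (simp add: lower_Lipschitz_const_def d_def)
  also have "\<dots> = L2_set (\<lambda>c. \<bar>b n r c M - b n r c N\<bar>) (Idx n r)"
    by (simp add: L2_set_def Phi_def)
  also have "\<dots> \<le> L2_set (\<lambda>c. \<delta>) (Idx n r)" using \<delta>(1) by (intro L2_set_mono) auto
  also have "\<dots> = sqrt (real ((n + r choose r) - 1)) * \<delta>"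
    using \<delta>(2) by (simp only: L2_set_constant card_Idx abs_of_nonneg)
  finally have d: "d \<le> sqrt (real ((n + r choose r) - 1)) / C * \<delta>"
    using \<open>0 < C\<close> by (simp add: field_simps)
  have "0 \<le> d" by (simp add: d_def \<pi>(2))
  have "\<bar>M v - row_act \<pi> N v\<bar> \<le> d" if "v \<in> {1..n} \<times> {1..r}" for v
  proof -
    have "\<bar>M v - row_act \<pi> N v\<bar> \<le> L2_set (\<lambda>p. \<bar>M p - row_act \<pi> N p\<bar>) ({1..n} \<times> {1..r})"
      using that by (intro member_le_L2_set) auto
    then show ?thesis by (simp add: d_def \<pi>(2) L2_set_def)
  qed
  then have "\<bar>teval (input_expr n r P Q) M - teval (input_expr n r P Q) (row_act \<pi> N)\<bar>
      \<le> real (Lip_bound n r P Q) * d"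
    using assms(1,2) \<open>0 \<le> d\<close> by (intro input_expr_Lipschitz) auto
  also have "teval (input_expr n r P Q) (row_act \<pi> N) = teval (input_expr n r P Q) N"
    using inv \<pi>(1) by (simp add: row_invariant_def)
  also have "real (Lip_bound n r P Q) * d \<le> real (Lip_bound n r P Q) * (sqrt (real ((n + r choose r) - 1)) / C * \<delta>)"
    using d by (intro mult_left_mono) auto
  finally show ?thesis by simp
qed

section \<open>The variables of the output\<close>

lemma teval_tmin_list: "ts \<noteq> [] \<Longrightarrow> teval (tmin_list ts) x = Min ((\<lambda>t. teval t x) ` set ts)"
  by (induction ts rule: tmin_list.induct) auto

lemma texp_vars_tmin_list: "texp_vars (tmin_list ts) = (\<Union>t\<in>set ts. texp_vars t)"
  by (induction ts rule: tmin_list.induct) auto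

lemma texp_vars_input_expr: "texp_vars (input_expr n r P Q) \<subseteq> set (entries n r)"
  by (auto simp: input_expr_def poly_expr_def texp_vars_tmax_list texp_vars_tsum_list)

text \<open>
  The expression for \<open>b\<^sub>c\<close> at a matrix of expressions is a substitution instance of the one in the
  matrix variables, whose variables are known.
\<close>

lemma texp_vars_b_expr_subset: "texp_vars (b_expr n r c m) \<subseteq> (\<Union>v\<in>set (entries n r). texp_vars (m v))"
proof -
  have "tsubst m (b_expr n r c TVar) = b_expr n r c m"
  proof -
    have sum: "tsubst m (tsum_list ts) = tsum_list (map (tsubst m) ts)" for ts :: "entry texp list"
      by (induction ts) (auto simp: tsum_list_def)
    have max: "tsubst m (tmax_list ts) = tmax_list (map (tsubst m) ts)" for ts :: "entry texp list"
      by (induction ts rule: tmax_list.induct) auto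
    show ?thesis
      by (simp add: b_expr_def max sum map_concat comp_def)
  qed
  then have "texp_vars (b_expr n r c m) = (\<Union>v\<in>texp_vars (b_expr n r c TVar). texp_vars (m v))"
    by (metis texp_vars_tsubst)
  then show ?thesis using texp_vars_b_expr by blast
qed

lemma texp_vars_M_hat:
  assumes "\<sigma> \<in> set (perm_tuples n r)" "v \<in> set (entries n r)"
  shows "texp_vars (M_hat \<sigma> v) \<subseteq> Idx n r"
proof -
  obtain i \<alpha> where v: "v = (i, \<alpha>)" "i \<in> {1..n}" "\<alpha> \<in> {1..r}"
    using assms(2) by (auto simp: set_entries)
  have coord: "texp_vars (pure_coord k \<alpha>) \<subseteq> Idx n r" if "k \<le> n" for k
    using pure_index_in_Idx[OF v(3), of k] that by (simp add: pure_coord_def)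
  define k where "k = \<sigma> ! (\<alpha> - 1) ! (i - 1)"
  have "k \<in> {1..n}" using bij_betwE[OF perm_tuples_bij[OF assms(1) v(3)]] v(2) unfolding k_def by blast
  then have "k \<le> n" "k - 1 \<le> n" by auto
  moreover have "M_hat \<sigma> v = TSub (pure_coord k \<alpha>) (pure_coord (k - 1) \<alpha>)"
    by (simp only: M_hat_def v(1) k_def Let_def prod.case)
  ultimately show ?thesis using coord[of k] coord[of "k - 1"] by auto
qed

lemma texp_vars_g_expr: "texp_vars (g_expr n r P Q \<kappa>) \<subseteq> Idx n r"
proof -
  have D: "texp_vars (D_expr n r \<sigma>) \<subseteq> Idx n r" if "\<sigma> \<in> set (perm_tuples n r)" for \<sigma>
    using texp_vars_b_expr_subset[of n r _ "M_hat \<sigma>"] texp_vars_M_hat[OF that]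
    by (fastforce simp: D_expr_def tabs_def texp_vars_tmax_list mixed_indices_iff)
  have f: "texp_vars (tsubst (M_hat \<sigma>) (input_expr n r P Q)) \<subseteq> Idx n r" if "\<sigma> \<in> set (perm_tuples n r)" for \<sigma>
    using texp_vars_input_expr[of n r P Q] texp_vars_M_hat[OF that]
    unfolding texp_vars_tsubst by blast
  show ?thesis
    using D f unfolding g_expr_def texp_vars_tmin_list by auto
qed

section \<open>Correctness and termination\<close>

lemma D_expr_ge:
  assumes "c \<in> set (mixed_indices n r)"
  shows "\<bar>w c - teval (b_expr n r c (M_hat \<sigma>)) w\<bar> \<le> teval (D_expr n r \<sigma>) w"
proof -
  define ts where "ts = [tabs (TSub (TVar c) (b_expr n r c (M_hat \<sigma>))). c \<leftarrow> mixed_indices n r]"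
  have "tabs (TSub (TVar c) (b_expr n r c (M_hat \<sigma>))) \<in> set ts" using assms by (auto simp: ts_def)
  then have "teval (tabs (TSub (TVar c) (b_expr n r c (M_hat \<sigma>)))) w \<le> Max ((\<lambda>t. teval t w) ` set ts)"
    and "ts \<noteq> []" by auto
  then show ?thesis unfolding D_expr_def ts_def[symmetric] by (auto simp: teval_tmax_list tabs_def)
qed

lemma D_expr_nonneg: "0 \<le> teval (D_expr n r \<sigma>) w"
proof (cases "mixed_indices n r")
  case Nil
  then show ?thesis by (simp add: D_expr_def)
next
  case (Cons c cs)
  then show ?thesis using D_expr_ge[of c n r w \<sigma>] by simp
qed

lemma D_expr_zero:
  assumes "\<And>c. c \<in> set (mixed_indices n r) \<Longrightarrow> teval (b_expr n r c (M_hat \<sigma>)) w = w c"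
  shows "teval (D_expr n r \<sigma>) w = 0"
proof (cases "mixed_indices n r = []")
  case True
  then show ?thesis by (simp add: D_expr_def)
next
  case False
  then have "teval (D_expr n r \<sigma>) w = Max ((\<lambda>c. 0) ` set (mixed_indices n r))"
    unfolding D_expr_def using assms
    by (subst teval_tmax_list) (auto simp: tabs_def image_image intro!: arg_cong[where f = Max] image_cong)
  then show ?thesis using False by (simp add: image_constant_conv)
qed

text \<open>
  Put \<open>w = \<Phi>(M)\<close>. Every reconstructed matrix has the columns of \<open>M\<close>, each in some order, so it agrees
  with \<open>M\<close> in all pure coordinates, and the coupling term \<open>D\<close> bounds its difference from \<open>M\<close> in the
  mixed ones. By \<open>invariant_Lipschitz\<close>, the penalty \<open>\<kappa> D\<close> outweighs any error in the
  value of \<open>f\<close>, so no term of the minimum is below \<open>f(M)\<close>. The tuple that couples the columns as in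
  \<open>M\<close> reconstructs a row permutation of \<open>M\<close>, and its term equals \<open>f(M)\<close>.
\<close>

lemma g_expr_correct:
  assumes "0 < r" and PQ: "P \<noteq> []" "Q \<noteq> []" and inv: "row_invariant n (input_expr n r P Q)"
    and C: "lower_Lipschitz_const n r C"
    and \<kappa>: "real (Lip_bound n r P Q) * sqrt (real ((n + r choose r) - 1)) / C \<le> of_int \<kappa>"
  shows "teval (g_expr n r P Q \<kappa>) (Phi n r M) = teval (input_expr n r P Q) M"
proof -
  define w where "w = Phi n r M"
  define f where "f = teval (input_expr n r P Q)"
  define N where "N \<sigma> p = teval (M_hat \<sigma> p) w" for \<sigma> p
  define g where "g \<sigma> = f (N \<sigma>) + of_int \<kappa> * teval (D_expr n r \<sigma>) w" for \<sigma>
  have f_cong: "f M = f N" if "\<And>i \<alpha>. i \<in> {1..n} \<Longrightarrow> \<alpha> \<in> {1..r} \<Longrightarrow> M (i, \<alpha>) = N (i, \<alpha>)" for M N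
    unfolding f_def using that texp_vars_input_expr[of n r P Q]
    by (intro teval_cong) (auto simp: set_entries)
  have w: "w c = b n r c M" if "c \<in> Idx n r" for c using that by (simp add: w_def Phi_def)
  have bN: "teval (b_expr n r c (M_hat \<sigma>)) w = b n r c (N \<sigma>)" if "c \<in> Idx n r" for c \<sigma>
    using b_expr_correct[OF that] by (simp add: N_def[abs_def])
  have "\<exists>s. s permutes {1..n} \<and> (\<forall>i j. 1 \<le> i \<longrightarrow> i \<le> j \<longrightarrow> j \<le> n \<longrightarrow> M (s j, \<alpha>) \<le> M (s i, \<alpha>))" for \<alpha>
    by (rule sorting_permutation)
  then obtain s where s: "\<And>\<alpha>. s \<alpha> permutes {1..n}"
    and anti: "\<And>\<alpha> i j. 1 \<le> i \<Longrightarrow> i \<le> j \<Longrightarrow> j \<le> n \<Longrightarrow> M (s \<alpha> j, \<alpha>) \<le> M (s \<alpha> i, \<alpha>)"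
    by metis
  define k where "k \<sigma> \<alpha> i = \<sigma> ! (\<alpha> - 1) ! (i - 1)" for \<sigma> :: "nat list list" and \<alpha> i
  have kbij: "bij_betw (k \<sigma> \<alpha>) {1..n} {1..n}" if "\<sigma> \<in> set (perm_tuples n r)" "\<alpha> \<in> {1..r}" for \<sigma> \<alpha>
    using perm_tuples_bij[OF that] by (simp only: k_def[abs_def])
  have N: "N \<sigma> (i, \<alpha>) = M (s \<alpha> (k \<sigma> \<alpha> i), \<alpha>)"
    if "\<sigma> \<in> set (perm_tuples n r)" "i \<in> {1..n}" "\<alpha> \<in> {1..r}" for \<sigma> i \<alpha>
  proof -
    have "\<sigma> ! (\<alpha> - 1) ! (i - 1) \<in> {1..n}"
      using bij_betwE[OF kbij[OF that(1,3)]] that(2) unfolding k_def by blast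
    then show ?thesis
      unfolding N_def k_def w_def using that(3) s anti by (intro teval_M_hat)
  qed
  have lower: "f M \<le> g \<sigma>" if \<sigma>: "\<sigma> \<in> set (perm_tuples n r)" for \<sigma>
  proof -
    define \<delta> where "\<delta> = teval (D_expr n r \<sigma>) w"
    have "0 \<le> \<delta>" by (simp add: \<delta>_def D_expr_nonneg)
    have "\<bar>b n r c M - b n r c (N \<sigma>)\<bar> \<le> \<delta>" if c: "c \<in> Idx n r" for c
      using c
    proof (cases rule: Idx_cases)
      case 1
      then show ?thesis using D_expr_ge[of c n r w \<sigma>] by (simp add: \<delta>_def w bN c)
    next
      case (2 \<alpha> j)
      \<comment> \<open>A pure coordinate sees only column \<open>\<alpha>\<close>, which the reconstruction permutes by \<open>p\<close>.\<close>
      define p where "p i = (if i \<in> {1..n} then s \<alpha> (k \<sigma> \<alpha> i) else i)" for i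
      have "bij_betw (s \<alpha> \<circ> k \<sigma> \<alpha>) {1..n} {1..n}"
        by (rule bij_betw_trans[OF kbij[OF \<sigma> 2(1)] permutes_imp_bij[OF s]])
      then have "bij_betw p {1..n} {1..n}"
        by (subst bij_betw_cong[of _ _ "s \<alpha> \<circ> k \<sigma> \<alpha>"]) (simp_all add: p_def)
      then have "p permutes {1..n}" by (rule bij_imp_permutes) (auto simp: p_def)
      then have "b n r c (N \<sigma>) = b n r c M"
        unfolding 2(3) using 2(1,2) N[OF \<sigma> _ 2(1)]
        by (intro b_pure_permute_column[where p = p]) (auto simp: p_def)
      then show ?thesis using \<open>0 \<le> \<delta>\<close> by simp
    qed
    then have "\<bar>f M - f (N \<sigma>)\<bar> \<le> real (Lip_bound n r P Q) * sqrt (real ((n + r choose r) - 1)) / C * \<delta>"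
      unfolding f_def using PQ inv C \<open>0 \<le> \<delta>\<close> by (intro invariant_Lipschitz) auto
    also have "\<dots> \<le> of_int \<kappa> * \<delta>" using \<kappa> \<open>0 \<le> \<delta>\<close> by (rule mult_right_mono)
    finally show ?thesis by (simp add: g_def \<delta>_def)
  qed
  have attained: "\<exists>\<sigma>\<in>set (perm_tuples n r). g \<sigma> = f M"
  proof -
    \<comment> \<open>Row \<open>i\<close> is to receive, in every column, the entries of row \<open>s 1 i\<close> of \<open>M\<close>; in column \<open>\<alpha>\<close>
      this entry has rank \<open>inv (s \<alpha>) (s 1 i)\<close>. For column 1 the rank is \<open>i\<close>.\<close>
    have "(inv (s \<alpha>) \<circ> s 1) permutes {1..n}" for \<alpha>
      by (intro permutes_compose permutes_inv s)
    moreover have "inv (s 1) \<circ> s 1 = id" using permutes_inv_o(2)[OF s] .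
    ultimately obtain \<sigma> where \<sigma>: "\<sigma> \<in> set (perm_tuples n r)"
      "\<And>\<alpha> i. \<alpha> \<in> {1..r} \<Longrightarrow> i \<in> {1..n} \<Longrightarrow> k \<sigma> \<alpha> i = (inv (s \<alpha>) \<circ> s 1) i"
      using perm_tuple_exists[OF \<open>0 < r\<close>, of "\<lambda>\<alpha>. inv (s \<alpha>) \<circ> s 1" n] unfolding k_def by blast
    have N1: "N \<sigma> (i, \<alpha>) = M (s 1 i, \<alpha>)" if "i \<in> {1..n}" "\<alpha> \<in> {1..r}" for i \<alpha>
      using N[OF \<sigma>(1) that] \<sigma>(2)[OF that(2,1)] permutes_inverses(1)[OF s] by simp
    have "b n r c (N \<sigma>) = b n r c M" for c
      using s[of 1] N1 by (rule b_permute_rows)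
    then have "teval (D_expr n r \<sigma>) w = 0"
      by (intro D_expr_zero) (simp add: mixed_indices_iff bN w)
    moreover have "f (N \<sigma>) = f (row_act (inv (s 1)) M)"
      using N1 by (intro f_cong) (simp add: row_act_def permutes_inv_inv[OF s])
    moreover have "f (row_act (inv (s 1)) M) = f M"
      using inv permutes_inv[OF s[of 1]] by (simp add: f_def row_invariant_def)
    ultimately have "g \<sigma> = f M" by (simp add: g_def)
    then show ?thesis using \<sigma>(1) by blast
  qed
  have "perm_tuples n r \<noteq> []" using attained by auto
  then have "teval (g_expr n r P Q \<kappa>) w = Min (g ` set (perm_tuples n r))"
    unfolding g_expr_def
    by (subst teval_tmin_list)
      (simp_all add: image_image teval_tsubst g_def f_def N_def[abs_def])
  also have "\<dots> = f M"
    using lower attained by (intro Min_eqI) (auto, metis image_eqI)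
  finally show ?thesis by (simp add: w_def f_def)
qed

lemma doubling_search_terminates:
  assumes "\<not> test (2 ^ k :: int)"
  shows "\<exists>\<kappa>. while_option test (\<lambda>\<kappa>. 2 * \<kappa>) 1 = Some \<kappa>"
proof -
  have "((\<lambda>\<kappa>. 2 * \<kappa>) ^^ k) 1 = (2 ^ k :: int)" by (induction k) auto
  then have "\<exists>k. \<not> test (((\<lambda>\<kappa>. 2 * \<kappa>) ^^ k) 1)" using assms by metis
  then show ?thesis unfolding while_option_def by auto
qed

text \<open>
  With a given constant, the ceiling makes the penalty large enough at once. In the search, the test
  decides the identity exactly, so whatever it accepts is correct, and it accepts as soon as \<open>2 ^ k\<close>
  exceeds the bound for some lower Lipschitz constant.
\<close>

theorem proposition3p12:
  fixes n r :: nat and P Q :: trop_poly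
  assumes "0 < n" and "0 < r"
    and "P \<noteq> []" and "Q \<noteq> []"
    and "row_invariant n (input_expr n r P Q)"
  shows
    "(\<forall>c\<^sub>n\<^sub>r c\<^sub>0. lower_Lipschitz_const n r c\<^sub>n\<^sub>r \<and> 0 < c\<^sub>0 \<and> c\<^sub>0 \<le> c\<^sub>n\<^sub>r \<longrightarrow>
        (\<exists>g. algorithm n r (Some c\<^sub>0) P Q = Some g \<and> texp_vars g \<subseteq> Idx n r \<and>
             (\<forall>M. teval g (Phi n r M) = teval (input_expr n r P Q) M))) \<and>
     (\<exists>g. algorithm n r None P Q = Some g \<and> texp_vars g \<subseteq> Idx n r \<and>
          (\<forall>M. teval g (Phi n r M) = teval (input_expr n r P Q) M))"
proof (intro conjI allI impI)
  define L where "L = real (Lip_bound n r P Q) * sqrt (real ((n + r choose r) - 1))"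
  have "0 \<le> L" by (simp add: L_def)
  have correct: "teval (g_expr n r P Q \<kappa>) (Phi n r M) = teval (input_expr n r P Q) M"
    if "lower_Lipschitz_const n r C" "L / C \<le> of_int \<kappa>" for C \<kappa> M
    using g_expr_correct[OF assms(2-5) that(1)] that(2) by (simp add: L_def)
  {
    fix c\<^sub>n\<^sub>r c\<^sub>0 :: real
    assume c: "lower_Lipschitz_const n r c\<^sub>n\<^sub>r \<and> 0 < c\<^sub>0 \<and> c\<^sub>0 \<le> c\<^sub>n\<^sub>r"
    \<comment> \<open>A smaller constant only enlarges the penalty.\<close>
    have "L / c\<^sub>n\<^sub>r \<le> L / c\<^sub>0" using c \<open>0 \<le> L\<close> by (intro divide_left_mono) auto
    also have "\<dots> \<le> of_int \<lceil>L / c\<^sub>0\<rceil>" by simp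
    finally have "teval (g_expr n r P Q \<lceil>L / c\<^sub>0\<rceil>) (Phi n r M) = teval (input_expr n r P Q) M" for M
      using correct c by blast
    then show "\<exists>g. algorithm n r (Some c\<^sub>0) P Q = Some g \<and> texp_vars g \<subseteq> Idx n r \<and>
        (\<forall>M. teval g (Phi n r M) = teval (input_expr n r P Q) M)"
      using texp_vars_g_expr by (simp add: algorithm_def L_def)
  }
  define test where "test \<kappa> = identity_test n r (g_expr n r P Q \<kappa>) (input_expr n r P Q)" for \<kappa>
  have test: "test \<kappa> \<longleftrightarrow> (\<forall>M. teval (g_expr n r P Q \<kappa>) (Phi n r M) = teval (input_expr n r P Q) M)" for \<kappa>
    unfolding test_def by (intro identity_test_iff texp_vars_g_expr texp_vars_input_expr)
  obtain C where C: "lower_Lipschitz_const n r C"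
    using lower_Lipschitz_const_exists[OF assms(1,2)] by blast
  obtain k where "L / C < 2 ^ k" using real_arch_pow[of 2 "L / C"] by auto
  then have "test (2 ^ k)" using correct[OF C] by (simp add: test)
  then obtain \<kappa> where \<kappa>: "while_option (\<lambda>\<kappa>. \<not> test \<kappa>) (\<lambda>\<kappa>. 2 * \<kappa>) 1 = Some \<kappa>"
    using doubling_search_terminates[of "\<lambda>\<kappa>. \<not> test \<kappa>" k] by blast
  then have "test \<kappa>" using while_option_stop by fastforce
  moreover have "algorithm n r None P Q = Some (g_expr n r P Q \<kappa>)"
    using \<kappa> by (simp add: algorithm_def test_def)
  ultimately show "\<exists>g. algorithm n r None P Q = Some g \<and> texp_vars g \<subseteq> Idx n r \<and>
      (\<forall>M. teval g (Phi n r M) = teval (input_expr n r P Q) M)"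
    using texp_vars_g_expr test by blast
qed

end
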